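(* Let $Y$ be a quasi-Polish space and let $X\subseteq Y$ be a co-analytic subset, with the subspace topology. Then either $X$ is quasi-Polish, or else $X$ contains a subset $S\in\mathbf{\Pi}^0_2(X)$ which (with the subspace topology) is homeomorphic to one of $S_0$, $S_D$, $S_1$, or $S_2$.
   Context: For a topological space $X$, define $\mathbf{\Sigma}^0_1(X)$ to be the set of open subsets of $X$, and for a countable ordinal $\alpha>1$ let $\mathbf{\Sigma}^0_\alpha(X)$ be the set of all $A\subseteq X$ of the form $A=\bigcup_{i\in\omega}B_i\setminus B_i'$ where for each $i$, $B_i,B_i'\in\mathbf{\Sigma}^0_{\beta_i}(X)$ for some $\beta_i<\alpha$. Let $\mathbf{\Pi}^0_\alpha(X)=\{X\setminus A : A\in\mathbf{\Sigma}^0_\alpha(X)\}$ and $\mathbf{\Delta}^0_\alpha(X)=\mathbf{\Sigma}^0_\alpha(X)\cap\mathbf{\Pi}^0_\alpha(X)$. A space is quasi-Polish if it is countably based (second countable) and its topology is induced by a Smyth-complete quasi-metric; equivalently (a known characterization, usable as the definition), if it is homeomorphic to a $\mathbf{\Pi}^0_2$-subset of $\mathcal{P}(\omega)$, the power set of $\omega$ with the Scott topology (basis: the sets $\{A\subseteq\omega : F\subseteq A\}$, $F$ finite). A subset $A$ of a quasi-Polish space $Y$ is analytic if $A=\emptyset$ or $A=f(\omega^\omega)$ for some continuous $f\colon\omega^\omega\to Y$ (with $\omega^\omega$ the Baire space of sequences of natural numbers). Co-analytic subsets are complements of analytic subsets. The four spaces are: $S_2$, the rational numbers with the subspace topology from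 the reals; $S_1$, the natural numbers with the cofinite topology; $S_D$, the natural numbers with the topology whose non-empty open sets are exactly the sets $\{m\in\omega : n\leq m\}$, $n\in\omega$; $S_0$, the set $\omega^{<\omega}$ of finite sequences of natural numbers with the topology for which the sets $\{q\in\omega^{<\omega} : p\preceq q\}$, $p\in\omega^{<\omega}$, form a subbasis of the closed sets, where $\preceq$ is the prefix relation. *)

theory Defs
  imports "HOL-Analysis.Analysis" "HOL-Library.Sublist"
begin

(* Borel hierarchy: only the finite levels n >= 1 are defined (level 2 is the only one used
   beyond the open sets), and no set has level 0. The use of differences B i - B' i, rather than
   closed sets, matters for spaces in which open sets need not be countable unions of closed sets. *)
inductive Sigma0 :: "'a topology \<Rightarrow> nat \<Rightarrow> 'a set \<Rightarrow> bool" for X :: "'a topology" where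
  Sigma0_open: "openin X A \<Longrightarrow> Sigma0 X 1 A"
| Sigma0_Union:
    "\<lbrakk>n > 1; \<forall>i::nat. 1 \<le> \<beta> i \<and> \<beta> i < n \<and> Sigma0 X (\<beta> i) (B i) \<and> Sigma0 X (\<beta> i) (B' i)\<rbrakk>
     \<Longrightarrow> Sigma0 X n (\<Union>i. B i - B' i)"

definition Pi0 :: "'a topology \<Rightarrow> nat \<Rightarrow> 'a set \<Rightarrow> bool" where
  "Pi0 X n B \<longleftrightarrow> (\<exists>A. Sigma0 X n A \<and> B = topspace X - A)"

lemma Sigma0_1_iff: "Sigma0 X 1 A \<longleftrightarrow> openin X A"
  by (metis Sigma0.cases Sigma0_open less_irrefl)

lemma Sigma0_2_iff:
  "Sigma0 X 2 A \<longleftrightarrow>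
    (\<exists>B B'. (\<forall>i::nat. openin X (B i) \<and> openin X (B' i)) \<and> A = (\<Union>i. B i - B' i))"
proof
  assume "Sigma0 X 2 A"
  then show "\<exists>B B'. (\<forall>i::nat. openin X (B i) \<and> openin X (B' i)) \<and> A = (\<Union>i. B i - B' i)"
  proof cases
    case (Sigma0_Union \<beta> B B')
    have "\<beta> i = 1" for i
      using Sigma0_Union(3) by (metis One_nat_def Suc_1 le_antisym less_Suc_eq_le)
    then show ?thesis
      using Sigma0_Union Sigma0_1_iff by metis
  qed simp
next
  assume "\<exists>B B'. (\<forall>i::nat. openin X (B i) \<and> openin X (B' i)) \<and> A = (\<Union>i. B i - B' i)"
  then obtain B B' where "\<forall>i::nat. openin X (B i) \<and> openin X (B' i)" "A = (\<Union>i. B i - B' i)"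
    by blast
  then show "Sigma0 X 2 A"
    using Sigma0.Sigma0_Union[of 2 "\<lambda>_. 1" X B B'] by (metis Sigma0_1_iff le_refl one_less_numeral_iff semiring_norm(76))
qed

definition scott_powerset :: "nat set topology" where
  "scott_powerset = topology_generated_by {{A. F \<subseteq> A} |F. finite F}"

lemma topspace_scott_powerset [simp]: "topspace scott_powerset = UNIV"
  unfolding scott_powerset_def by (auto simp: topology_generated_by_topspace)

(* The characterization of quasi-Polish spaces up to homeomorphism is taken as the definition. *)
definition quasi_polish :: "'a topology \<Rightarrow> bool" where
  "quasi_polish X \<longleftrightarrow>
    (\<exists>P. Pi0 scott_powerset 2 P \<and> X homeomorphic_space subtopology scott_powerset P)"

definition baire_space :: "(nat \<Rightarrow> nat) topology" where
  "baire_space = product_topology (\<lambda>_. discrete_topology UNIV) UNIV"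

lemma topspace_baire_space [simp]: "topspace baire_space = UNIV"
  by (simp add: baire_space_def PiE_UNIV_domain)

definition analytic_in :: "'a topology \<Rightarrow> 'a set \<Rightarrow> bool" where
  "analytic_in Y A \<longleftrightarrow> A = {} \<or> (\<exists>f. continuous_map baire_space Y f \<and> A = range f)"

definition coanalytic_in :: "'a topology \<Rightarrow> 'a set \<Rightarrow> bool" where
  "coanalytic_in Y X \<longleftrightarrow> (\<exists>A. analytic_in Y A \<and> X = topspace Y - A)"

(* Closed subbasis given by the upper cones of the prefix order. *)
definition S_0 :: "nat list topology" where
  "S_0 = topology_generated_by {- {q. prefix p q} |p. True}"

lemma topspace_S_0 [simp]: "topspace S_0 = UNIV"
proof -
  have "\<exists>p. \<not> prefix p q" for q :: "nat list"
    by (rule exI[of _ "0 # q"]) (auto dest: prefix_length_le)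
  then show ?thesis
    unfolding S_0_def topology_generated_by_topspace by blast
qed

definition S_D :: "nat topology" where
  "S_D = topology (\<lambda>U. U = {} \<or> (\<exists>n. U = {m. n \<le> m}))"

definition S_1 :: "nat topology" where
  "S_1 = topology (\<lambda>U. U = {} \<or> finite (- U))"

definition S_2 :: "real topology" where
  "S_2 = subtopology euclideanreal \<rat>"

lemma openin_S_D: "openin S_D U \<longleftrightarrow> U = {} \<or> (\<exists>n. U = {m. n \<le> m})"
proof -
  have eq: "(U = {} \<or> (\<exists>n. U = {m. n \<le> m})) \<longleftrightarrow> (\<forall>x\<in>U. \<forall>y\<ge>x. y \<in> U)" for U :: "nat set"
  proof
    assume up: "\<forall>x\<in>U. \<forall>y\<ge>x. y \<in> U"
    have "U = {m. (LEAST k. k \<in> U) \<le> m}" if "U \<noteq> {}"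
      using that up by (auto intro: Least_le LeastI)
    then show "U = {} \<or> (\<exists>n. U = {m. n \<le> m})" by blast
  qed auto
  have "istopology (\<lambda>U :: nat set. \<forall>x\<in>U. \<forall>y\<ge>x. y \<in> U)"
    unfolding istopology_def by blast
  then show ?thesis
    unfolding S_D_def eq by (simp add: topology_inverse')
qed

lemma openin_S_1: "openin S_1 U \<longleftrightarrow> U = {} \<or> finite (- U)"
proof -
  have "istopology (\<lambda>U :: nat set. U = {} \<or> finite (- U))"
    unfolding istopology_def
  proof (intro conjI allI impI)
    fix \<K> :: "nat set set"
    assume *: "\<forall>K\<in>\<K>. K = {} \<or> finite (- K)"
    show "\<Union>\<K> = {} \<or> finite (- \<Union>\<K>)"
    proof (cases "\<Union>\<K> = {}")
      case False
      then obtain K where "K \<in> \<K>" "K \<noteq> {}" by auto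
      with * have "finite (- K)" by blast
      moreover have "- \<Union>\<K> \<subseteq> - K" using \<open>K \<in> \<K>\<close> by blast
      ultimately show ?thesis using finite_subset by blast
    qed simp
  qed (auto simp: Compl_Int)
  then show ?thesis
    unfolding S_1_def by (simp add: topology_inverse')
qed

end

theory Submission
  imports Defs
begin

text \<open>
  Everything happens in \<open>P(\<omega>)\<close>, whose Scott topology is compared with the finer Cantor topology;
  Cantor-closed sets are \<open>\<Pi>\<^sup>0\<^sub>2\<close> for the Scott topology. If the analytic complement of \<open>X\<close> cannot be
  separated from \<open>X\<close> by a Scott-\<open>\<Sigma>\<^sup>0\<^sub>2\<close> set, a Hurewicz-style derivation produces points
  \<open>x s \<in> X\<close> indexed by finite sequences, such that the subtrees above \<open>s @ [n]\<close> Cantor-converge, as \<open>n\<close>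
  grows, to some \<open>a s \<supseteq> x s\<close>, and the infinite branches converge to points outside \<open>X\<close>. Either
  \<open>a s = x s\<close> throughout (no Cantor-\<open>F\<^sub>\<sigma>\<close> set separates), or every \<open>a s\<close> lies outside \<open>X\<close> (a Cantor-closed set
  disjoint from \<open>X\<close> is already inseparable in the Scott sense, and its points are approximated by elements
  of \<open>X\<close> below other points of it). Then the inclusions between the points are made homogeneous by passing
  to subtrees. A sequence in \<open>X\<close> that converges from below to a point outside \<open>X\<close> yields \<open>S_D\<close>
  (a chain) or \<open>S_1\<close> (an antichain); without such sequences one ends with either \<open>x (s @ [n]) \<subseteq> x s\<close> and no
  other inclusions, which is \<open>S_0\<close>, or with a zero-dimensional tree topology, which is that of the
  rationals.
\<close>

section \<open>The Scott topology and closeness on initial segments\<close>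

text \<open>Two notions of separation are needed because the topologies differ at level two. A
  Scott-\<open>Sigma0\<close> 2 set is a Cantor F-sigma set, but \<open>{UNIV}\<close> is
  Cantor-closed and not Scott-\<open>Sigma0\<close> 2, since every nonempty Scott-open set contains
  \<open>UNIV\<close>. Thus the chain of the sets \<open>{..<n}\<close> is a Cantor G-delta set and
  yet a copy of \<open>S_D\<close>. The classical Hurewicz derivation sees only the Cantor side;
  where it leaves nothing, the second kind of scheme has to take over, with the Scott closure
  supplying the points of \<open>X\<close>. The four spaces are the possible patterns of inclusion:
  a chain, an antichain below a limit, the reversed prefix order, no inclusion at all. Each copy is
  cut out of \<open>X\<close> by a Cantor closure, which is why every limit in the constructions
  must either be one of the chosen points or lie outside \<open>X\<close>.\<close>

lemma openin_scott_iff: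
  "openin scott_powerset U \<longleftrightarrow> (\<forall>y\<in>U. \<exists>F. finite F \<and> F \<subseteq> y \<and> {A. F \<subseteq> A} \<subseteq> U)"
proof
  assume "openin scott_powerset U"
  then have "generate_topology_on {{A. F \<subseteq> A} |F :: nat set. finite F} U"
    by (simp add: scott_powerset_def openin_topology_generated_by_iff)
  then show "\<forall>y\<in>U. \<exists>F. finite F \<and> F \<subseteq> y \<and> {A. F \<subseteq> A} \<subseteq> U"
  proof induction
    case (Int a b)
    show ?case
    proof
      fix y assume "y \<in> a \<inter> b"
      then obtain F G where "finite F" "F \<subseteq> y" "{A. F \<subseteq> A} \<subseteq> a" "finite G" "G \<subseteq> y" "{A. G \<subseteq> A} \<subseteq> b"
        using Int by (meson IntE)
      then show "\<exists>F. finite F \<and> F \<subseteq> y \<and> {A. F \<subseteq> A} \<subseteq> a \<inter> b"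
        by (intro exI[of _ "F \<union> G"]) auto
    qed
  next
    case (UN K)
    then show ?case by (meson UnionE Union_upper subset_trans)
  qed auto
next
  assume *: "\<forall>y\<in>U. \<exists>F. finite F \<and> F \<subseteq> y \<and> {A. F \<subseteq> A} \<subseteq> U"
  have "openin scott_powerset {A. F \<subseteq> A}" if "finite F" for F
    unfolding scott_powerset_def by (rule topology_generated_by_Basis) (use that in auto)
  with * show "openin scott_powerset U"
    by (subst openin_subopen) (metis mem_Collect_eq)
qed

lemma openin_scott_supersets: "finite F \<Longrightarrow> openin scott_powerset {A. F \<subseteq> A}"
  by (auto simp: openin_scott_iff)

lemma openin_scott_meets: "openin scott_powerset {A. A \<inter> G \<noteq> {}}"
  unfolding openin_scott_iff
proof
  fix y assume "y \<in> {A. A \<inter> G \<noteq> {}}"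
  then obtain k where "k \<in> y" "k \<in> G" by auto
  then show "\<exists>F. finite F \<and> F \<subseteq> y \<and> {A. F \<subseteq> A} \<subseteq> {A. A \<inter> G \<noteq> {}}"
    by (intro exI[of _ "{k}"]) auto
qed

lemma Pi0_2_iff:
  "Pi0 X 2 P \<longleftrightarrow>
    (\<exists>U V. (\<forall>i::nat. openin X (U i) \<and> openin X (V i)) \<and> P = topspace X - (\<Union>i. U i - V i))"
  unfolding Pi0_def Sigma0_2_iff by blast

lemma Pi0_2_Int:
  assumes "Pi0 X 2 P" "Pi0 X 2 Q"
  shows "Pi0 X 2 (P \<inter> Q)"
proof -
  obtain U V where UV: "\<forall>i::nat. openin X (U i) \<and> openin X (V i)" "P = topspace X - (\<Union>i. U i - V i)"
    using assms(1) unfolding Pi0_2_iff by blast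
  obtain U' V' where UV': "\<forall>i::nat. openin X (U' i) \<and> openin X (V' i)"
      "Q = topspace X - (\<Union>i. U' i - V' i)"
    using assms(2) unfolding Pi0_2_iff by blast
  define W where "W i = (if even i then U (i div 2) else U' (i div 2))" for i
  define W' where "W' i = (if even i then V (i div 2) else V' (i div 2))" for i
  have "(\<Union>i. W i - W' i) = (\<Union>i. U i - V i) \<union> (\<Union>i. U' i - V' i)"
  proof
    show "(\<Union>i. W i - W' i) \<subseteq> (\<Union>i. U i - V i) \<union> (\<Union>i. U' i - V' i)"
      by (auto simp: W_def W'_def split: if_splits)
    have "U i - V i = W (2 * i) - W' (2 * i)" "U' i - V' i = W (2 * i + 1) - W' (2 * i + 1)" for i
      by (auto simp: W_def W'_def)
    then show "(\<Union>i. U i - V i) \<union> (\<Union>i. U' i - V' i) \<subseteq> (\<Union>i. W i - W' i)"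
      by blast
  qed
  then have "P \<inter> Q = topspace X - (\<Union>i. W i - W' i)"
    unfolding UV(2) UV'(2) Diff_Un[symmetric] by (rule arg_cong[OF sym])
  moreover have "\<forall>i. openin X (W i) \<and> openin X (W' i)"
    using UV(1) UV'(1) by (auto simp: W_def W'_def)
  ultimately show ?thesis unfolding Pi0_2_iff by blast
qed

section \<open>Agreement on initial segments and the two closures\<close>

definition agree :: "nat \<Rightarrow> nat set \<Rightarrow> nat set \<Rightarrow> bool" where
  "agree m x y \<longleftrightarrow> (\<forall>k<m. k \<in> x \<longleftrightarrow> k \<in> y)"

lemma agree_refl [simp]: "agree m x x"
  by (simp add: agree_def)

lemma agree_sym: "agree m x y \<Longrightarrow> agree m y x"
  by (simp add: agree_def)

lemma agree_trans [trans]: "agree m x y \<Longrightarrow> agree m y z \<Longrightarrow> agree m x z"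
  by (simp add: agree_def)

lemma agree_mono: "agree n x y \<Longrightarrow> m \<le> n \<Longrightarrow> agree m x y"
  by (simp add: agree_def)

lemma agree_eqI: "(\<And>m. agree m x y) \<Longrightarrow> x = y"
  unfolding agree_def by blast

definition cantor_cl :: "nat set set \<Rightarrow> nat set set" where
  "cantor_cl Z = {y. \<forall>m. \<exists>z\<in>Z. agree m y z}"

definition scott_cl :: "nat set set \<Rightarrow> nat set set" where
  "scott_cl Z = {y. \<forall>F. finite F \<longrightarrow> F \<subseteq> y \<longrightarrow> (\<exists>z\<in>Z. F \<subseteq> z)}"

lemma cantor_cl_mono: "Z \<subseteq> W \<Longrightarrow> cantor_cl Z \<subseteq> cantor_cl W"
  unfolding cantor_cl_def by blast

lemma subset_cantor_cl: "Z \<subseteq> cantor_cl Z"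
  unfolding cantor_cl_def using agree_refl by blast

lemma cantor_cl_idem: "cantor_cl (cantor_cl Z) = cantor_cl Z"
proof
  show "cantor_cl (cantor_cl Z) \<subseteq> cantor_cl Z"
    unfolding cantor_cl_def using agree_trans by fast
qed (rule subset_cantor_cl)

lemma cantor_cl_agree:
  assumes "y \<in> cantor_cl Z" "\<And>z. z \<in> Z \<Longrightarrow> agree m z b"
  shows "agree m y b"
  using assms agree_trans unfolding cantor_cl_def by blast

text \<open>A point outside the closure lies in a cylinder that misses \<open>Z\<close>. The sets
  that contain a finite \<open>F\<close> and agree with it below \<open>m\<close> form the
  Scott-open set of supersets of \<open>F\<close> minus the Scott-open set of sets meeting
  \<open>{..<m} - F\<close>, and the pairs \<open>(m, F)\<close> are enumerated by decoding
  \<open>i\<close>.\<close>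

lemma Pi0_cantor_cl: "Pi0 scott_powerset 2 (cantor_cl Z)"
proof -
  define far where "far i = (\<forall>z\<in>Z. \<not> agree (fst (prod_decode i)) (set_decode (snd (prod_decode i))) z)" for i
  define U where "U i = (if far i then {A. set_decode (snd (prod_decode i)) \<subseteq> A} else {})" for i
  define V where "V i = {A. A \<inter> ({..<fst (prod_decode i)} - set_decode (snd (prod_decode i))) \<noteq> {}}" for i
  have "openin scott_powerset (U i)" "openin scott_powerset (V i)" for i
    unfolding U_def V_def using openin_scott_meets
    by (auto intro: openin_scott_supersets)
  moreover have "cantor_cl Z = UNIV - (\<Union>i. U i - V i)"
  proof (intro set_eqI iffI)
    fix y assume y: "y \<in> cantor_cl Z"
    show "y \<in> UNIV - (\<Union>i. U i - V i)"
    proof (clarsimp)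
      fix i assume "y \<in> U i"
      then have far: "far i" and sub: "set_decode (snd (prod_decode i)) \<subseteq> y"
        by (auto simp: U_def split: if_splits)
      show "y \<in> V i"
      proof (rule ccontr)
        assume "y \<notin> V i"
        with sub have "agree (fst (prod_decode i)) (set_decode (snd (prod_decode i))) y"
          by (auto simp: V_def agree_def)
        moreover obtain z where "z \<in> Z" "agree (fst (prod_decode i)) y z"
          using y by (auto simp: cantor_cl_def)
        ultimately show False using far agree_trans unfolding far_def by blast
      qed
    qed
  next
    fix y assume y: "y \<in> UNIV - (\<Union>i. U i - V i)"
    show "y \<in> cantor_cl Z"
    proof (rule ccontr)
      assume "y \<notin> cantor_cl Z"
      then obtain m where m: "\<forall>z\<in>Z. \<not> agree m y z" by (auto simp: cantor_cl_def)
      define i where "i = prod_encode (m, set_encode (y \<inter> {..<m}))"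
      have [simp]: "fst (prod_decode i) = m" "set_decode (snd (prod_decode i)) = y \<inter> {..<m}"
        by (simp_all add: i_def set_encode_inverse)
      have "agree m (y \<inter> {..<m}) z = agree m y z" for z by (auto simp: agree_def)
      with m have "far i" by (simp add: far_def)
      then have "y \<in> U i - V i" by (auto simp: U_def V_def)
      with y show False by blast
    qed
  qed
  ultimately show ?thesis unfolding Pi0_2_iff topspace_scott_powerset by blast
qed

text \<open>Compactness of the Cantor space: elements of \<open>Z\<close> that contain longer and
  longer pieces of \<open>x\<close> accumulate at some \<open>a\<close>, which then contains
  \<open>x\<close>. The bits of \<open>a\<close> are chosen one at a time; \<open>ok m F\<close>
  says that the first \<open>m\<close> bits of \<open>F\<close> are shared by elements of
  \<open>Z\<close> containing arbitrarily long pieces of \<open>x\<close>.\<close>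

lemma scott_cl_subset_down:
  assumes "x \<in> scott_cl Z"
  shows "\<exists>a\<in>cantor_cl Z. x \<subseteq> a"
proof -
  define ok where "ok m F \<longleftrightarrow> (\<forall>j. \<exists>z\<in>Z. agree m z F \<and> x \<inter> {..<j} \<subseteq> z)" for m F
  have 0: "ok 0 {}"
  proof -
    have "\<exists>z\<in>Z. x \<inter> {..<j} \<subseteq> z" for j
      using assms unfolding scott_cl_def by simp
    then show ?thesis by (simp add: ok_def agree_def)
  qed
  have step: "\<exists>G. ok (Suc m) G \<and> agree m F G" if "ok m F" for m F
  proof (rule ccontr)
    assume neg: "\<nexists>G. ok (Suc m) G \<and> agree m F G"
    have "agree m F (insert m F)" "agree m F (F - {m})" by (auto simp: agree_def)
    with neg have "\<not> ok (Suc m) (insert m F)" "\<not> ok (Suc m) (F - {m})" by auto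
    then obtain i j where ij: "\<forall>z\<in>Z. agree (Suc m) z (insert m F) \<longrightarrow> \<not> x \<inter> {..<i} \<subseteq> z"
      "\<forall>z\<in>Z. agree (Suc m) z (F - {m}) \<longrightarrow> \<not> x \<inter> {..<j} \<subseteq> z"
      unfolding ok_def by blast
    \<comment> \<open>A single \<open>z\<close> that meets both bounds has to decide bit
      \<open>m\<close> one way or the other.\<close>
    obtain z where z: "z \<in> Z" "agree m z F" "x \<inter> {..<max i j} \<subseteq> z"
      using \<open>ok m F\<close> unfolding ok_def by blast
    have "agree (Suc m) z (insert m F) \<or> agree (Suc m) z (F - {m})"
      using z(2) by (auto simp: agree_def less_Suc_eq)
    moreover have "x \<inter> {..<i} \<subseteq> z" "x \<inter> {..<j} \<subseteq> z" using z(3) by auto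
    ultimately show False using ij z(1) by blast
  qed
  have "\<exists>f. f 0 = {} \<and> (\<forall>m. ok m (f m) \<and> agree m (f m) (f (Suc m)))"
    using dependent_nat_choice[of "\<lambda>m F. ok m F \<and> (m = 0 \<longrightarrow> F = {})" "\<lambda>m F G. agree m F G"] 0 step
    by (metis nat.distinct(1))
  then obtain f where f: "\<And>m. ok m (f m)" "\<And>m. agree m (f m) (f (Suc m))" by blast
  have f_le: "agree m (f m) (f n)" if "m \<le> n" for m n
    using that
  proof (induction n rule: dec_induct)
    case (step n)
    then show ?case using f(2)[of n] agree_mono agree_trans by blast
  qed simp
  \<comment> \<open>Bit \<open>k\<close> is final from stage \<open>Suc k\<close> on.\<close>
  define a where "a = {k. k \<in> f (Suc k)}"
  have fa: "agree m (f m) a" for m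
    unfolding agree_def a_def using f_le by (auto simp: agree_def Suc_le_eq)
  have "a \<in> cantor_cl Z"
    unfolding cantor_cl_def
  proof (intro CollectI allI)
    fix m
    obtain z where "z \<in> Z" "agree m z (f m)" using f(1)[of m] unfolding ok_def by blast
    then show "\<exists>z\<in>Z. agree m a z" using fa[of m] agree_trans agree_sym by blast
  qed
  moreover have "x \<subseteq> a"
  proof
    fix k assume "k \<in> x"
    obtain z where "z \<in> Z" "agree (Suc k) z (f (Suc k))" "x \<inter> {..<Suc k} \<subseteq> z"
      using f(1) unfolding ok_def by blast
    with \<open>k \<in> x\<close> have "k \<in> f (Suc k)" by (auto simp: agree_def)
    then show "k \<in> a" by (simp add: a_def)
  qed
  ultimately show ?thesis by blast
qed

text \<open>The index sets given by \<open>F \<subseteq> g t\<close>, with \<open>F\<close> finite,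
  form a base of the Scott topology on the range. They are open in \<open>T\<close> by
  \<open>cont\<close> and fine enough by \<open>nbhd\<close>. Every canonical copy is recognised
  through this test.\<close>

lemma homeomorphic_scott_range:
  fixes g :: "'b \<Rightarrow> nat set"
  assumes "topspace T = UNIV" "inj g"
    and cont: "\<And>k. openin T {t. k \<in> g t}"
    and nbhd: "\<And>U t. openin T U \<Longrightarrow> t \<in> U \<Longrightarrow> \<exists>F. finite F \<and> F \<subseteq> g t \<and> (\<forall>t'. F \<subseteq> g t' \<longrightarrow> t' \<in> U)"
  shows "subtopology scott_powerset (range g) homeomorphic_space T"
proof -
  have "continuous_map T scott_powerset g"
    unfolding continuous_map_def
  proof (intro conjI allI impI)
    fix U assume U: "openin scott_powerset U"
    have "\<exists>W. openin T W \<and> t \<in> W \<and> W \<subseteq> {x \<in> topspace T. g x \<in> U}" if t: "g t \<in> U" for t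
    proof -
      obtain F where F: "finite F" "F \<subseteq> g t" "{A. F \<subseteq> A} \<subseteq> U"
        using U[unfolded openin_scott_iff, rule_format, OF t] by blast
      define W where "W = {t. F \<subseteq> g t}"
      have "openin T {t. F \<subseteq> g t}" using F(1)
      proof induction
        case empty
        then show ?case using openin_topspace[of T] assms(1) by simp
      next
        case (insert k F)
        have "{t. insert k F \<subseteq> g t} = {t. k \<in> g t} \<inter> {t. F \<subseteq> g t}" by auto
        then show ?case using insert cont by (simp add: openin_Int)
      qed
      then have "openin T W" by (simp add: W_def)
      moreover have "t \<in> W" "W \<subseteq> {x \<in> topspace T. g x \<in> U}"
        using F unfolding W_def assms(1) by auto
      ultimately show ?thesis by blast
    qed
    then show "openin T {x \<in> topspace T. g x \<in> U}"
      using assms(1) by (subst openin_subopen) simp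
  qed simp
  then have c: "continuous_map T (subtopology scott_powerset (range g)) g"
    by (simp add: continuous_map_in_subtopology assms(1))
  have o: "open_map T (subtopology scott_powerset (range g)) g"
    unfolding open_map_def
  proof (intro allI impI)
    fix U assume U: "openin T U"
    \<comment> \<open>The largest Scott-open set whose trace on the range stays inside the image of
      \<open>U\<close>.\<close>
    define W where "W = {A. \<exists>F. finite F \<and> F \<subseteq> A \<and> (\<forall>t'. F \<subseteq> g t' \<longrightarrow> t' \<in> U)}"
    have "openin scott_powerset W"
      unfolding openin_scott_iff W_def by blast
    moreover have "g t \<in> W \<longleftrightarrow> t \<in> U" for t
      using nbhd[OF U] unfolding W_def by blast
    then have "g ` U = W \<inter> range g" by blast
    ultimately show "openin (subtopology scott_powerset (range g)) (g ` U)"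
      unfolding openin_subtopology by blast
  qed
  have "homeomorphic_map T (subtopology scott_powerset (range g)) g"
    by (rule bijective_open_imp_homeomorphic_map[OF c o]) (use assms in auto)
  then show ?thesis
    using homeomorphic_map_imp_homeomorphic_space homeomorphic_space_sym by blast
qed

text \<open>Reduces the \<open>nbhd\<close> condition of \<open>homeomorphic_scott_range\<close> to
  a subbasis: for an intersection, the finite witnesses are united.\<close>

lemma generated_nbhd:
  fixes g :: "'b \<Rightarrow> nat set"
  assumes "\<And>U t. U \<in> B \<Longrightarrow> t \<in> U \<Longrightarrow> \<exists>F. finite F \<and> F \<subseteq> g t \<and> (\<forall>t'. F \<subseteq> g t' \<longrightarrow> t' \<in> U)"
    and "openin (topology_generated_by B) U" "t \<in> U"
  shows "\<exists>F. finite F \<and> F \<subseteq> g t \<and> (\<forall>t'. F \<subseteq> g t' \<longrightarrow> t' \<in> U)"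
proof -
  have "generate_topology_on B U"
    using assms(2) by (simp add: openin_topology_generated_by_iff)
  then show ?thesis using assms(3)
  proof (induction arbitrary: t)
    case (Int a b)
    then have "t \<in> a" "t \<in> b" by auto
    obtain F where "finite F" "F \<subseteq> g t" "\<forall>t'. F \<subseteq> g t' \<longrightarrow> t' \<in> a"
      using Int.IH(1)[OF \<open>t \<in> a\<close>] by blast
    moreover obtain G where "finite G" "G \<subseteq> g t" "\<forall>t'. G \<subseteq> g t' \<longrightarrow> t' \<in> b"
      using Int.IH(2)[OF \<open>t \<in> b\<close>] by blast
    ultimately show ?case by (intro exI[of _ "F \<union> G"]) auto
  next
    case (UN K)
    then obtain k where k: "k \<in> K" "t \<in> k" by blast
    obtain F where "finite F" "F \<subseteq> g t" "\<forall>t'. F \<subseteq> g t' \<longrightarrow> t' \<in> k"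
      using UN.IH[OF k] by blast
    with k(1) show ?case by (intro exI[of _ F]) auto
  next
    case (Basis s)
    show ?case by (rule assms(1)[OF Basis])
  next
    case Empty
    then show ?case by (rule emptyE)
  qed
qed

section \<open>Limits from below and schemes\<close>

text \<open>The second alternative of the theorem, moved into P(\<omega>). The level-two set
  \<open>Q\<close> is taken in the whole space so that it can be pulled back along an embedding of
  \<open>Y\<close>.\<close>

definition has_canonical :: "nat set set \<Rightarrow> bool" where
  "has_canonical X \<longleftrightarrow> (\<exists>Q. Pi0 scott_powerset 2 Q \<and>
      (subtopology scott_powerset (X \<inter> Q) homeomorphic_space S_0 \<or>
       subtopology scott_powerset (X \<inter> Q) homeomorphic_space S_D \<or>
       subtopology scott_powerset (X \<inter> Q) homeomorphic_space S_1 \<or>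
       subtopology scott_powerset (X \<inter> Q) homeomorphic_space S_2))"

text \<open>The Cantor closure of \<open>S\<close> serves as the level-two set, so it is enough that
  \<open>S\<close> is Cantor-closed relative to \<open>X\<close>.\<close>

lemma has_canonicalI:
  assumes "S = X \<inter> cantor_cl S"
    and "subtopology scott_powerset S homeomorphic_space S_0 \<or>
       subtopology scott_powerset S homeomorphic_space S_D \<or>
       subtopology scott_powerset S homeomorphic_space S_1 \<or>
       subtopology scott_powerset S homeomorphic_space S_2"
  shows "has_canonical X"
  using assms Pi0_cantor_cl[of S] unfolding has_canonical_def by metis

section \<open>Convergent sequences and copies of S_D and S_1\<close>

definition converges :: "(nat \<Rightarrow> nat set) \<Rightarrow> nat set \<Rightarrow> bool" where
  "converges y b \<longleftrightarrow> (\<forall>m. \<exists>N. \<forall>i\<ge>N. agree m (y i) b)"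

lemma converges_subseq:
  assumes "converges y b" "strict_mono g"
  shows "converges (y \<circ> g) b"
  unfolding converges_def
proof
  fix m
  obtain N where "\<forall>i\<ge>N. agree m (y i) b" using assms(1) unfolding converges_def by blast
  moreover have "N \<le> g i" if "N \<le> i" for i
    using strict_mono_imp_increasing[OF assms(2), of i] that by linarith
  ultimately have "\<forall>i\<ge>N. agree m ((y \<circ> g) i) b" by simp
  then show "\<exists>N. \<forall>i\<ge>N. agree m ((y \<circ> g) i) b" ..
qed

lemma converges_mem:
  assumes "converges y b" "k \<in> b"
  shows "\<exists>N. \<forall>i\<ge>N. k \<in> y i"
proof -
  obtain N where "\<forall>i\<ge>N. agree (Suc k) (y i) b" using assms(1) unfolding converges_def by blast
  with assms(2) show ?thesis unfolding agree_def by blast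
qed

lemma increasing_converges_subset:
  assumes "converges y b" "\<And>i. y i \<subseteq> y (Suc i)"
  shows "y i \<subseteq> b"
proof
  fix k assume k: "k \<in> y i"
  obtain N where N: "\<forall>j\<ge>N. agree (Suc k) (y j) b"
    using assms(1)[unfolded converges_def, rule_format, of "Suc k"] by blast
  have "y i \<subseteq> y (max i N)" by (rule lift_Suc_mono_le[of y, OF assms(2)]) simp
  with k have "k \<in> y (max i N)" by blast
  moreover have "agree (Suc k) (y (max i N)) b" using N by simp
  ultimately show "k \<in> b" unfolding agree_def by blast
qed

lemma disagree_finite:
  assumes "\<forall>i<N. w \<noteq> y i"
  shows "\<exists>M. \<forall>i<N::nat. \<not> agree M w (y i)"
  using assms
proof (induction N)
  case (Suc N)
  then obtain M where M: "\<forall>i<N. \<not> agree M w (y i)" by auto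
  obtain M' where M': "\<not> agree M' w (y N)" using Suc.prems agree_eqI by blast
  have "\<not> agree (max M M') w (y i)" if "i < Suc N" for i
    using that M M' agree_mono[of "max M M'" w "y i" M] agree_mono[of "max M M'" w "y i" M']
    by (cases "i = N") auto
  then show ?case by blast
qed simp

text \<open>Outside its range the sequence has no Cantor limit except \<open>b\<close>, which
  \<open>X\<close> omits.\<close>

lemma range_convergent_closed:
  assumes "\<And>i. y i \<in> X" "converges y b" "b \<notin> X"
  shows "range y = X \<inter> cantor_cl (range y)"
proof
  show "range y \<subseteq> X \<inter> cantor_cl (range y)" using assms(1) subset_cantor_cl[of "range y"] by auto
  show "X \<inter> cantor_cl (range y) \<subseteq> range y"
  proof
    fix w assume w: "w \<in> X \<inter> cantor_cl (range y)"
    show "w \<in> range y"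
    proof (rule ccontr)
      assume neg: "w \<notin> range y"
      from w assms(3) obtain m where m: "\<not> agree m w b" using agree_eqI by blast
      obtain N where N: "\<forall>i\<ge>N. agree m (y i) b" using assms(2) unfolding converges_def by blast
      obtain M where M: "\<forall>i<N. \<not> agree M w (y i)" using disagree_finite neg by blast
      from w have "\<exists>z\<in>range y. agree (max m M) w z" unfolding cantor_cl_def by blast
      then obtain i where i: "agree (max m M) w (y i)" by blast
      show False
      proof (cases "i < N")
        case True
        with M i agree_mono[of "max m M" w "y i" M] show False by simp
      next
        case False
        with N i agree_mono[of "max m M" w "y i" m] m show False
          using agree_trans by (metis max.cobounded1 not_less)
      qed
    qed
  qed
qed

lemma range_homeomorphic_S_D:
  fixes z :: "nat \<Rightarrow> nat set"
  assumes "\<And>n. z n \<subset> z (Suc n)"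
  shows "subtopology scott_powerset (range z) homeomorphic_space S_D"
proof (rule homeomorphic_scott_range)
  have mono: "z m \<subseteq> z n" if "m \<le> n" for m n
    using lift_Suc_mono_le[of z] assms that by blast
  have strict: "z m \<subset> z n" if "m < n" for m n
    using lift_Suc_mono_less[of z] assms that by blast
  have "openin S_D {m. 0 \<le> m}" unfolding openin_S_D by blast
  then show "topspace S_D = UNIV" using openin_subset by fastforce
  show "inj z"
    by (rule injI) (metis strict less_irrefl nat_neq_iff)
  show "openin S_D {t. k \<in> z t}" for k
  proof (cases "\<exists>t. k \<in> z t")
    case True
    then have "k \<in> z (LEAST t. k \<in> z t)" by (rule LeastI_ex)
    then have "{t. k \<in> z t} = {m. (LEAST t. k \<in> z t) \<le> m}"
      using mono by (blast intro: Least_le)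
    then show ?thesis unfolding openin_S_D by blast
  qed (simp add: openin_S_D)
  fix U t assume "openin S_D U" "t \<in> U"
  then obtain n where U: "U = {m. n \<le> m}" unfolding openin_S_D by blast
  show "\<exists>F. finite F \<and> F \<subseteq> z t \<and> (\<forall>t'. F \<subseteq> z t' \<longrightarrow> t' \<in> U)"
  proof (cases n)
    case 0
    then show ?thesis using U by (intro exI[of _ "{}"]) auto
  next
    case (Suc n')
    \<comment> \<open>An element that is new at stage \<open>n\<close> pins down the final segment
      starting at \<open>n\<close>.\<close>
    then obtain k where k: "k \<in> z n" "k \<notin> z n'" using assms[of n'] by blast
    have "n \<le> t'" if "k \<in> z t'" for t'
      using that k mono[of t' n'] Suc by (meson not_less_eq_eq subsetD)
    moreover have "k \<in> z t" using mono[of n t] \<open>t \<in> U\<close> U k by blast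
    ultimately show ?thesis using U by (intro exI[of _ "{k}"]) auto
  qed
qed

text \<open>An element of \<open>b\<close> lies in almost all \<open>z i\<close> and any other
  number in none, so the subbasic traces are empty or cofinite. Conversely, the finitely many
  indices outside a cofinite set are excluded by one element of \<open>z t\<close> each, since the
  \<open>z i\<close> form an antichain.\<close>

lemma range_homeomorphic_S_1:
  fixes z :: "nat \<Rightarrow> nat set"
  assumes "\<And>i j. i \<noteq> j \<Longrightarrow> \<not> z i \<subseteq> z j" "\<And>i. z i \<subseteq> b" "converges z b"
  shows "subtopology scott_powerset (range z) homeomorphic_space S_1"
proof (rule homeomorphic_scott_range)
  have "openin S_1 UNIV" unfolding openin_S_1 by simp
  then show "topspace S_1 = UNIV" using openin_subset by fastforce
  show "inj z"
    by (rule injI) (metis assms(1) order_refl)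
  show "openin S_1 {t. k \<in> z t}" for k
  proof (cases "k \<in> b")
    case True
    then obtain N where "\<forall>i\<ge>N. k \<in> z i" using converges_mem assms(3) by blast
    then have "- {t. k \<in> z t} \<subseteq> {..<N}" by (auto simp: not_less[symmetric])
    then show ?thesis unfolding openin_S_1 using finite_subset by blast
  next
    case False
    then have "{t. k \<in> z t} = {}" using assms(2) by blast
    then show ?thesis unfolding openin_S_1 by blast
  qed
  fix U t assume "openin S_1 U" "t \<in> U"
  then have U: "finite (- U)" unfolding openin_S_1 by blast
  have "\<forall>j\<in>-U. \<exists>k. k \<in> z t \<and> k \<notin> z j"
    using assms(1) \<open>t \<in> U\<close> by (metis ComplD subsetI)
  then obtain k where k: "\<forall>j\<in>-U. k j \<in> z t \<and> k j \<notin> z j" by metis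
  show "\<exists>F. finite F \<and> F \<subseteq> z t \<and> (\<forall>t'. F \<subseteq> z t' \<longrightarrow> t' \<in> U)"
    using U k by (intro exI[of _ "k ` (- U)"]) auto
qed

text \<open>Turns a bound \<open>h m\<close>, beyond which every index behaves well relative to
  \<open>m\<close>, into a subsequence that behaves well for all pairs.\<close>

lemma exists_sparse_seq:
  fixes h :: "nat \<Rightarrow> nat"
  shows "\<exists>g :: nat \<Rightarrow> nat. strict_mono g \<and> D \<le> g 0 \<and> (\<forall>m n. m < n \<longrightarrow> h (g m) \<le> g n)"
proof -
  define B where "B c = Suc c + (\<Sum>i\<le>c. h i)" for c
  define g where "g = rec_nat D (\<lambda>_. B)"
  have g_simps: "g 0 = D" "g (Suc n) = B (g n)" for n by (simp_all add: g_def)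
  have "g n < g (Suc n)" for n by (simp add: g_simps B_def)
  then have sm: "strict_mono g" by (simp add: strict_mono_Suc_iff)
  have "h c \<le> g (Suc n)" if "c \<le> g n" for c n
    unfolding g_simps B_def using that member_le_sum[of c "{..g n}" h] by simp
  moreover have "g m \<le> g n" if "m < Suc n" for m n
    using that sm strict_mono_less_eq by (simp add: less_Suc_eq_le strict_mono_less_eq)
  ultimately have "h (g m) \<le> g n" if "m < n" for m n
    using that by (cases n) auto
  with sm show ?thesis by (intro exI[of _ g]) (simp add: g_simps)
qed

text \<open>As \<open>b\<close> is no \<open>y i\<close>, some element of \<open>b\<close> is
  missing from \<open>y i\<close> but belongs to all late \<open>y j\<close>; hence in a sparse
  subsequence \<open>u\<close> no term contains a later one. A Ramsey alternative remains: if from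
  some point on every term is included in a later one, there is a strictly increasing chain;
  otherwise infinitely many terms have no later superset, and these form an antichain.\<close>

lemma converging_from_below:
  assumes X: "\<And>i. y i \<in> X" and below: "\<And>i. y i \<subseteq> b" and conv: "converges y b" and b: "b \<notin> X"
  shows "has_canonical X"
proof -
  have "\<exists>N. \<forall>j\<ge>N. \<not> y j \<subseteq> y i" for i
  proof -
    have "b \<noteq> y i" using X[of i] b by auto
    then obtain k where "k \<in> b" "k \<notin> y i" using below[of i] by blast
    with converges_mem[OF conv] show ?thesis by blast
  qed
  then obtain h where h: "\<And>i j. h i \<le> j \<Longrightarrow> \<not> y j \<subseteq> y i" by metis
  obtain g :: "nat \<Rightarrow> nat" where g: "strict_mono g" "\<forall>m n. m < n \<longrightarrow> h (g m) \<le> g n"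
    using exists_sparse_seq[of 0 h] by blast
  define u where "u = y \<circ> g"
  have uX: "u i \<in> X" and ub: "u i \<subseteq> b" for i using X below by (auto simp: u_def)
  have uconv: "converges u b" unfolding u_def by (rule converges_subseq[OF conv g(1)])
  have u: "\<not> u j \<subseteq> u i" if "i < j" for i j using h g(2) that by (simp add: u_def)
  show ?thesis
  proof (cases "\<exists>i0. \<forall>i\<ge>i0. \<exists>j>i. u i \<subseteq> u j")
    case True
    then obtain i0 where i0: "\<And>i. i0 \<le> i \<Longrightarrow> \<exists>j>i. u i \<subseteq> u j" by blast
    obtain f where f: "\<And>n. i0 \<le> f n \<and> f n < f (Suc n) \<and> u (f n) \<subseteq> u (f (Suc n))"
    proof -
      have "\<exists>j. i0 \<le> j \<and> i < j \<and> u i \<subseteq> u j" if "i0 \<le> i" for i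
        using i0[OF that] that by (meson less_imp_le order_trans)
      then show thesis
        using dependent_nat_choice[of "\<lambda>_ i. i0 \<le> i" "\<lambda>_ i j. i < j \<and> u i \<subseteq> u j"] that
        by blast
    qed
    then have "strict_mono f" by (simp add: strict_mono_Suc_iff)
    then have "range (u \<circ> f) = X \<inter> cantor_cl (range (u \<circ> f))"
      using uX b uconv converges_subseq by (intro range_convergent_closed[of _ _ b]) auto
    moreover have "u (f n) \<subset> u (f (Suc n))" for n
      using f[of n] u[of "f n" "f (Suc n)"] by blast
    then have "subtopology scott_powerset (range (u \<circ> f)) homeomorphic_space S_D"
      by (intro range_homeomorphic_S_D) simp
    ultimately show ?thesis using has_canonicalI by blast
  next
    case False
    then have inf: "\<exists>i\<ge>i0. \<forall>j>i. \<not> u i \<subseteq> u j" for i0 by blast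
    then have step: "\<exists>j>i. \<forall>l>j. \<not> u j \<subseteq> u l" for i
      by (metis Suc_le_eq)
    obtain f where f: "\<And>n. (\<forall>j>f n. \<not> u (f n) \<subseteq> u j) \<and> f n < f (Suc n)"
      using dependent_nat_choice[of "\<lambda>_ i. \<forall>j>i. \<not> u i \<subseteq> u j" "\<lambda>_ i j. i < j"] step
      by metis
    then have sm: "strict_mono f" by (simp add: strict_mono_Suc_iff)
    then have cl: "range (u \<circ> f) = X \<inter> cantor_cl (range (u \<circ> f))"
      using uX b uconv converges_subseq by (intro range_convergent_closed[of _ _ b]) auto
    have "\<not> u (f i) \<subseteq> u (f j)" if "i \<noteq> j" for i j
      using that f u sm by (metis nat_neq_iff strict_mono_less)
    then have "subtopology scott_powerset (range (u \<circ> f)) homeomorphic_space S_1"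
      by (intro range_homeomorphic_S_1[of _ b])
        (use ub converges_subseq[OF uconv sm] in auto)
    with cl show ?thesis using has_canonicalI by blast
  qed
qed

section \<open>Schemes of points and passage to subtrees\<close>

lemma tree_choice:
  fixes I :: "'v \<Rightarrow> bool"
  assumes "I v" "\<And>v n. I v \<Longrightarrow> \<exists>w. I w \<and> R v n w"
  shows "\<exists>\<phi> :: 'n list \<Rightarrow> 'v. \<phi> [] = v \<and> (\<forall>s. I (\<phi> s)) \<and> (\<forall>s n. R (\<phi> s) n (\<phi> (s @ [n])))"
proof -
  obtain f where f: "\<And>v n. I v \<Longrightarrow> I (f v n) \<and> R v n (f v n)" using assms(2) by metis
  \<comment> \<open>The node at \<open>s\<close> is reached by folding the chosen successor function
    along \<open>s\<close>.\<close>
  have "I (foldl f v s)" for s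
    by (induction s rule: rev_induct) (use assms(1) f in auto)
  with f show ?thesis by (intro exI[of _ "foldl f v"]) simp
qed

text \<open>The point \<open>a s\<close> is the Cantor limit of the subtrees above \<open>s @ [n]\<close>. Because of \<open>node\<close> and
  \<open>branch\<close>, a Cantor limit of the points \<open>x s\<close> is itself such a point or lies outside \<open>X\<close>.\<close>

locale scheme =
  fixes X :: "nat set set" and x a :: "nat list \<Rightarrow> nat set"
  assumes mem: "x s \<in> X" and below: "x s \<subseteq> a s"
    and lim: "\<exists>N. \<forall>n\<ge>N. \<forall>t. agree m (x (s @ n # t)) (a s)"
    and branch: "(\<And>n. strict_prefix (p n) (p (Suc n))) \<Longrightarrow>
      \<exists>b. b \<notin> X \<and> (\<forall>m. \<exists>n. \<forall>t. agree m (x (p n @ t)) b)"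
    and node: "(\<forall>s. a s = x s) \<or> (\<forall>s. a s \<notin> X)"
begin

lemma eventually_mem:
  assumes "k \<in> a s"
  shows "\<exists>N. \<forall>n\<ge>N. \<forall>t. k \<in> x (s @ n # t)"
proof -
  obtain N where "\<forall>n\<ge>N. \<forall>t. agree (Suc k) (x (s @ n # t)) (a s)" using lim by blast
  with assms show ?thesis unfolding agree_def by blast
qed

lemma eventually_not_mem:
  assumes "k \<notin> a s"
  shows "\<exists>N. \<forall>n\<ge>N. \<forall>t. k \<notin> x (s @ n # t)"
proof -
  obtain N where "\<forall>n\<ge>N. \<forall>t. agree (Suc k) (x (s @ n # t)) (a s)" using lim by blast
  with assms show ?thesis unfolding agree_def by blast
qed

text \<open>The estimate in \<open>branch\<close> covers the whole subtree above \<open>p n\<close>,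
  so the limit is shared by all sequences whose \<open>n\<close>-th node lies above
  \<open>p n\<close>, even if they leave the branch.\<close>

lemma branch_converges:
  assumes "\<And>n. strict_prefix (p n) (p (Suc n))"
  obtains b where "b \<notin> X" "\<And>q. (\<And>n. prefix (p n) (q n)) \<Longrightarrow> converges (\<lambda>n. x (q n)) b"
proof -
  obtain b where b: "b \<notin> X" "\<forall>m. \<exists>n. \<forall>t. agree m (x (p n @ t)) b"
    using branch assms by blast
  have mono: "prefix (p m) (p n)" if "m \<le> n" for m n
    using that
  proof (induction n rule: dec_induct)
    case (step n)
    then show ?case using assms[of n] prefix_order.trans strict_prefix_def by blast
  qed simp
  have "converges (\<lambda>n. x (q n)) b" if q: "\<And>n. prefix (p n) (q n)" for q
    unfolding converges_def
  proof
    fix m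
    obtain n where n: "\<forall>t. agree m (x (p n @ t)) b" using b by blast
    have "agree m (x (q i)) b" if "n \<le> i" for i
    proof -
      have "prefix (p n) (q i)" using mono[OF that] q[of i] prefix_order.trans by blast
      then show ?thesis using n by (auto simp: prefix_def)
    qed
    then show "\<exists>N. \<forall>i\<ge>N. agree m (x (q i)) b" by blast
  qed
  with b that show thesis by blast
qed

text \<open>A Koenig argument along the nodes whose subtrees come arbitrarily close to
  \<open>w\<close>. If no child of such a node is near, \<open>w\<close> is \<open>x s\<close> or
  \<open>a s\<close>, and by \<open>node\<close> the latter is a chosen point or lies outside
  \<open>X\<close>. If the descent never stops, \<open>w\<close> is the limit of a branch and lies
  outside \<open>X\<close>.\<close>

lemma range_closed: "range x = X \<inter> cantor_cl (range x)"
proof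
  show "range x \<subseteq> X \<inter> cantor_cl (range x)" using mem subset_cantor_cl[of "range x"] by auto
  show "X \<inter> cantor_cl (range x) \<subseteq> range x"
  proof
    fix w assume w: "w \<in> X \<inter> cantor_cl (range x)"
    show "w \<in> range x"
    proof (rule ccontr)
      assume neg: "w \<notin> range x"
      define near where "near s \<longleftrightarrow> (\<forall>m. \<exists>t. agree m w (x (s @ t)))" for s
      have "near []" using w unfolding near_def cantor_cl_def by fastforce
      have step: "\<exists>n. near (s @ [n])" if "near s" for s
      proof (rule ccontr)
        assume "\<nexists>n. near (s @ [n])"
        then have "\<forall>n. \<exists>m. \<forall>t. \<not> agree m w (x (s @ n # t))" unfolding near_def by simp
        then obtain h where h: "\<And>n t. \<not> agree (h n) w (x (s @ n # t))" by metis
        have "w \<noteq> a s" using node neg w by auto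
        then obtain m where m: "\<not> agree m w (a s)" using agree_eqI by blast
        obtain N where N: "\<And>n t. N \<le> n \<Longrightarrow> agree m (x (s @ n # t)) (a s)" using lim by blast
        obtain m' where m': "\<not> agree m' w (x s)" using neg agree_eqI by blast
        \<comment> \<open>A precision that tells \<open>w\<close> from \<open>x s\<close>, from the
          limit \<open>a s\<close>, and from the finitely many subtrees with
          \<open>n < N\<close>.\<close>
        define M where "M = m + m' + (\<Sum>n<N. h n)"
        obtain t where t: "agree M w (x (s @ t))" using \<open>near s\<close> near_def by blast
        show False
        proof (cases t)
          case Nil
          with t m' agree_mono[of M w "x s" m'] show False by (simp add: M_def)
        next
          case (Cons n t')
          show False
          proof (cases "n < N")
            case True
            then have "h n \<le> M" unfolding M_def using member_le_sum[of n "{..<N}" h] by simp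
            with t Cons h show False using agree_mono by blast
          next
            case False
            then have "agree m (x (s @ t)) (a s)" using N Cons by simp
            moreover have "agree m w (x (s @ t))" using t agree_mono by (simp add: M_def agree_def)
            ultimately show False using m agree_trans by blast
          qed
        qed
      qed
      obtain p where p: "\<And>n. near (p n) \<and> (\<exists>c. p (Suc n) = p n @ [c])"
        using dependent_nat_choice[of "\<lambda>_. near" "\<lambda>_ s s'. \<exists>c. s' = s @ [c]"] \<open>near []\<close> step
        by blast
      have "strict_prefix (p n) (p (Suc n))" for n
      proof -
        obtain c where "p (Suc n) = p n @ [c]" using p[of n] by blast
        then show ?thesis by (rule strict_prefixI')
      qed
      then obtain b where b: "b \<notin> X" "\<forall>m. \<exists>n. \<forall>t. agree m (x (p n @ t)) b"
        using branch by blast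
      then obtain m where m: "\<not> agree m w b" using w agree_eqI by blast
      obtain n where "\<forall>t. agree m (x (p n @ t)) b" using b by blast
      with p[of n] m show False unfolding near_def using agree_trans by blast
    qed
  qed
qed

end

text \<open>Passage to a subtree in which every node keeps infinitely many directions. The condition
  \<open>c \<ge> n\<close> carries \<open>lim\<close> over with the same bound \<open>N\<close>;
  distinct \<open>n\<close> may share a \<open>c\<close>.\<close>

definition thinning :: "(nat list \<Rightarrow> nat list) \<Rightarrow> bool" where
  "thinning \<phi> \<longleftrightarrow> (\<forall>s n. \<exists>c\<ge>n. \<exists>t. \<phi> (s @ [n]) = \<phi> s @ c # t)"

lemma thinning_prefix:
  assumes "thinning \<phi>"
  shows "\<exists>u. \<phi> (s @ t) = \<phi> s @ u"
proof (induction t rule: rev_induct)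
  case (snoc n t)
  moreover obtain c u where "\<phi> ((s @ t) @ [n]) = \<phi> (s @ t) @ c # u"
    using assms unfolding thinning_def by blast
  ultimately show ?case by force
qed simp

lemma thinning_append:
  assumes "thinning \<phi>"
  shows "\<exists>c\<ge>n. \<exists>u. \<phi> (s @ n # t) = \<phi> s @ c # u"
proof -
  obtain c u where "c \<ge> n" "\<phi> (s @ [n]) = \<phi> s @ c # u"
    using assms unfolding thinning_def by blast
  moreover obtain v where "\<phi> ((s @ [n]) @ t) = \<phi> (s @ [n]) @ v"
    using thinning_prefix[OF assms] by blast
  ultimately show ?thesis by auto
qed

lemma thinning_strict_prefix:
  assumes "thinning \<phi>" "strict_prefix s t"
  shows "strict_prefix (\<phi> s) (\<phi> t)"
proof -
  obtain n u where t: "t = s @ n # u" using assms(2) by (rule strict_prefixE')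
  obtain c v where "\<phi> (s @ n # u) = \<phi> s @ c # v" using thinning_append[OF assms(1)] by blast
  with t show ?thesis by (simp add: strict_prefix_def)
qed

lemma thinning_shift: "thinning (\<lambda>s. r @ s)"
  unfolding thinning_def by auto

lemma (in scheme) thin:
  assumes "thinning \<phi>"
  shows "scheme X (\<lambda>s. x (\<phi> s)) (\<lambda>s. a (\<phi> s))"
proof
  show "\<exists>N. \<forall>n\<ge>N. \<forall>t. agree m (x (\<phi> (s @ n # t))) (a (\<phi> s))" for m s
  proof -
    obtain N where "\<forall>n\<ge>N. \<forall>t. agree m (x (\<phi> s @ n # t)) (a (\<phi> s))" using lim by blast
    moreover have "\<exists>c\<ge>n. \<exists>u. \<phi> (s @ n # t) = \<phi> s @ c # u" for n t
      using thinning_append[OF assms] .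
    ultimately show ?thesis by (metis order_trans)
  qed
  show "\<exists>b. b \<notin> X \<and> (\<forall>m. \<exists>n. \<forall>t. agree m (x (\<phi> (p n @ t))) b)"
    if p: "\<And>n. strict_prefix (p n) (p (Suc n))" for p
  proof -
    have "strict_prefix (\<phi> (p n)) (\<phi> (p (Suc n)))" for n
      by (rule thinning_strict_prefix[OF assms p])
    then
    obtain b where b: "b \<notin> X" "\<forall>m. \<exists>n. \<forall>t. agree m (x (\<phi> (p n) @ t)) b"
      using branch[of "\<lambda>n. \<phi> (p n)"] by blast
    then have "\<exists>n. \<forall>t. agree m (x (\<phi> (p n @ t))) b" for m
      using thinning_prefix[OF assms] by metis
    with b show ?thesis by blast
  qed
qed (use mem below node in auto)

text \<open>If above some node every point is included in a further one, an increasing branch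
  converges from below to a point outside \<open>X\<close>. Otherwise the nodes whose point is
  included in no later one are dense, and the new tree uses only those.\<close>

lemma (in scheme) separated_thinning:
  assumes top: "\<And>s. a s = x s"
  shows "has_canonical X \<or>
    (\<exists>\<phi>. thinning \<phi> \<and> (\<forall>s n. \<exists>k\<in>x (\<phi> s). \<forall>t. k \<notin> x (\<phi> (s @ n # t))))"
proof (cases "\<exists>r. \<forall>s. prefix r s \<longrightarrow> (\<exists>t. strict_prefix s t \<and> x s \<subseteq> x t)")
  case True
  then obtain r where r: "\<And>s. prefix r s \<Longrightarrow> \<exists>t. strict_prefix s t \<and> x s \<subseteq> x t" by blast
  have "\<exists>t. prefix r t \<and> strict_prefix s t \<and> x s \<subseteq> x t" if "prefix r s" for s
    using r[OF that] that prefix_order.less_imp_le prefix_order.trans by metis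
  then obtain p where p: "\<And>n. prefix r (p n) \<and> strict_prefix (p n) (p (Suc n)) \<and> x (p n) \<subseteq> x (p (Suc n))"
    using dependent_nat_choice[of "\<lambda>_. prefix r" "\<lambda>_ s t. strict_prefix s t \<and> x s \<subseteq> x t"]
      prefix_order.refl[of r] by blast
  then obtain b where b: "b \<notin> X" "\<And>q. (\<And>n. prefix (p n) (q n)) \<Longrightarrow> converges (\<lambda>n. x (q n)) b"
    using branch_converges[of p] by blast
  have conv: "converges (\<lambda>n. x (p n)) b" using b(2)[of p] by simp
  have "x (p n) \<subseteq> b" for n by (rule increasing_converges_subset[OF conv]) (use p in blast)
  then have "has_canonical X" using converging_from_below[OF mem _ conv b(1)] by blast
  then show ?thesis ..
next
  case False
  define good where "good s \<longleftrightarrow> (\<forall>t. strict_prefix s t \<longrightarrow> \<not> x s \<subseteq> x t)" for s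
  have dense: "\<exists>s. prefix r s \<and> good s" for r using False unfolding good_def by blast
  then obtain v where v: "good v" by blast
  have step: "\<exists>w. good w \<and> ((\<exists>c\<ge>n. \<exists>t. w = v @ c # t) \<and> (\<exists>k\<in>x v. \<forall>u. k \<notin> x (w @ u)))"
    if "good v" for v n
  proof -
    obtain t' where t': "prefix (v @ [n]) t'" "good t'" using dense by blast
    then obtain t where t: "t' = v @ n # t" by (auto simp: prefix_def)
    then have "strict_prefix v t'" by (rule strict_prefixI')
    then obtain k where k: "k \<in> x v" "k \<notin> x t'" using \<open>good v\<close> unfolding good_def by blast
    \<comment> \<open>As \<open>k\<close> is missing from \<open>x t'\<close>, which is the limit
      \<open>a t'\<close>, it is missing from all far subtrees above \<open>t'\<close>; moving into
      one of them loses \<open>k\<close> for good.\<close>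
    obtain N where N: "\<forall>c\<ge>N. \<forall>u. k \<notin> x (t' @ c # u)"
      using eventually_not_mem[of k t'] k top by auto
    obtain w where w: "prefix (t' @ [N]) w" "good w" using dense by blast
    then obtain u where u: "w = t' @ N # u" by (auto simp: prefix_def)
    then have "\<forall>u. k \<notin> x (w @ u)" using N by simp
    moreover have "w = v @ n # (t @ N # u)" using t u by simp
    ultimately show ?thesis using w(2) k(1) by blast
  qed
  obtain \<phi> :: "nat list \<Rightarrow> nat list" where \<phi>:
    "\<forall>s n. (\<exists>c\<ge>n. \<exists>t. \<phi> (s @ [n]) = \<phi> s @ c # t) \<and>
      (\<exists>k\<in>x (\<phi> s). \<forall>u. k \<notin> x (\<phi> (s @ [n]) @ u))"
    using tree_choice[of good v
      "\<lambda>v n w. (\<exists>c\<ge>n. \<exists>t. w = v @ c # t) \<and> (\<exists>k\<in>x v. \<forall>u. k \<notin> x (w @ u))", OF v step] by blast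
  then have th: "thinning \<phi>" unfolding thinning_def by blast
  have "\<exists>k\<in>x (\<phi> s). \<forall>t. k \<notin> x (\<phi> (s @ n # t))" for s n
  proof -
    obtain k where k: "k \<in> x (\<phi> s)" "\<forall>u. k \<notin> x (\<phi> (s @ [n]) @ u)" using \<phi> by blast
    have "k \<notin> x (\<phi> (s @ n # t))" for t
      using thinning_prefix[OF th, of "s @ [n]" t] k(2) by auto
    with k(1) show ?thesis by blast
  qed
  with th show ?thesis by blast
qed

text \<open>Nodes with the eventual property are dense, so the new tree can be confined to them;
  leaving each node only beyond its bound \<open>N\<close> makes the property hold for all
  children.\<close>

lemma (in scheme) not_below_thinning:
  assumes dense: "\<And>r. \<exists>s. prefix r s \<and> (\<exists>N. \<forall>n\<ge>N. \<forall>t. \<not> x (s @ n # t) \<subseteq> a s)"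
  shows "\<exists>\<phi>. thinning \<phi> \<and> (\<forall>s n t. \<not> x (\<phi> (s @ n # t)) \<subseteq> a (\<phi> s))"
proof -
  define good where "good s \<longleftrightarrow> (\<exists>N. \<forall>n\<ge>N. \<forall>t. \<not> x (s @ n # t) \<subseteq> a s)" for s
  have dense': "\<exists>s. prefix r s \<and> good s" for r using dense unfolding good_def by blast
  then obtain v where v: "good v" by blast
  have step: "\<exists>w. good w \<and> ((\<exists>c\<ge>n. \<exists>t. w = v @ c # t) \<and> (\<forall>u. \<not> x (w @ u) \<subseteq> a v))"
    if "good v" for v n
  proof -
    obtain N where N: "\<forall>n\<ge>N. \<forall>t. \<not> x (v @ n # t) \<subseteq> a v"
      using \<open>good v\<close> unfolding good_def by blast
    obtain w where w: "prefix (v @ [max n N]) w" "good w" using dense' by blast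
    then obtain t where t: "w = v @ max n N # t" by (auto simp: prefix_def)
    then have "\<forall>u. \<not> x (w @ u) \<subseteq> a v" using N by simp
    moreover have "n \<le> max n N" by simp
    ultimately show ?thesis using w(2) t by blast
  qed
  obtain \<phi> :: "nat list \<Rightarrow> nat list" where \<phi>:
    "\<forall>s n. (\<exists>c\<ge>n. \<exists>t. \<phi> (s @ [n]) = \<phi> s @ c # t) \<and>
      (\<forall>u. \<not> x (\<phi> (s @ [n]) @ u) \<subseteq> a (\<phi> s))"
    using tree_choice[of good v
      "\<lambda>v n w. (\<exists>c\<ge>n. \<exists>t. w = v @ c # t) \<and> (\<forall>u. \<not> x (w @ u) \<subseteq> a v)", OF v step] by blast
  then have th: "thinning \<phi>" unfolding thinning_def by blast
  have "\<not> x (\<phi> (s @ n # t)) \<subseteq> a (\<phi> s)" for s n t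
  proof -
    obtain u where "\<phi> ((s @ [n]) @ t) = \<phi> (s @ [n]) @ u" using thinning_prefix[OF th] by blast
    moreover have "\<not> x (\<phi> (s @ [n]) @ u) \<subseteq> a (\<phi> s)" for u using \<phi> by blast
    ultimately show ?thesis by auto
  qed
  with th show ?thesis by blast
qed

text \<open>The topology of \<open>S_0\<close> with the cones made open as well, so that
  \<open>s @ n # t\<close> tends to \<open>s\<close>, and to nothing else, as \<open>n\<close>
  grows.\<close>

definition tree_topology :: "nat list topology" where
  "tree_topology = topology_generated_by
    ({{q. prefix p q} | p. True} \<union> {- {q. prefix p q} | p. True})"

lemma topspace_tree_topology [simp]: "topspace tree_topology = UNIV"
  unfolding tree_topology_def topology_generated_by_topspace by blast

lemma openin_tree_cone: "openin tree_topology {q. prefix p q}"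
  and openin_tree_cocone: "openin tree_topology (- {q. prefix p q})"
  unfolding tree_topology_def by (rule topology_generated_by_Basis; blast)+

text \<open>The cone of \<open>s\<close> without the cones of finitely many children is a
  neighbourhood of \<open>s\<close>.\<close>

lemma openin_treeI:
  assumes "\<And>s. s \<in> U \<Longrightarrow> \<exists>N. \<forall>n\<ge>N. \<forall>t. s @ n # t \<in> U"
  shows "openin tree_topology U"
proof (subst openin_subopen, intro ballI)
  fix s assume s: "s \<in> U"
  obtain N where N: "\<And>n t. N \<le> n \<Longrightarrow> s @ n # t \<in> U" using assms[OF s] by blast
  \<comment> \<open>\<open>Suc N\<close> keeps the index set of the intersection nonempty.\<close>
  define W where "W = {q. prefix s q} \<inter> (\<Inter>n<Suc N. - {q. prefix (s @ [n]) q})"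
  have "openin tree_topology (\<Inter>n<Suc N. - {q. prefix (s @ [n]) q})"
    by (intro openin_INT2) (auto simp: openin_tree_cocone)
  then have "openin tree_topology W"
    unfolding W_def by (intro openin_Int openin_tree_cone)
  moreover have "s \<in> W" unfolding W_def by auto
  moreover have "W \<subseteq> U"
  proof
    fix q assume q: "q \<in> W"
    then obtain t where t: "q = s @ t" unfolding W_def by (auto simp: prefix_def)
    show "q \<in> U"
    proof (cases t)
      case Nil
      with s t show ?thesis by simp
    next
      case (Cons n t')
      then have "prefix (s @ [n]) q" using t by simp
      then have "\<not> n < Suc N" using q unfolding W_def by blast
      then show ?thesis using N Cons t by simp
    qed
  qed
  ultimately show "\<exists>T. openin tree_topology T \<and> s \<in> T \<and> T \<subseteq> U" by blast
qed

section \<open>The tree topology and the rationals\<close>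

definition clopen_rat :: "real set \<Rightarrow> bool" where
  "clopen_rat C \<longleftrightarrow> C \<subseteq> \<rat> \<and>
    (\<forall>q\<in>\<rat>. \<exists>e>0. \<forall>q'\<in>\<rat>. \<bar>q' - q\<bar> < e \<longrightarrow> (q' \<in> C \<longleftrightarrow> q \<in> C))"

lemma clopen_rat_openin:
  assumes C: "clopen_rat C"
  shows "openin S_2 C \<and> openin S_2 (\<rat> - C)"
proof -
  have "C \<subseteq> \<rat>" and
   *: "\<And>q. q \<in> \<rat> \<Longrightarrow> \<exists>e>0. \<forall>q'\<in>\<rat>. \<bar>q' - q\<bar> < e \<longrightarrow> (q' \<in> C \<longleftrightarrow> q \<in> C)"
    using C unfolding clopen_rat_def by auto
  have "\<exists>e>0. \<forall>q'\<in>\<rat>. \<bar>q' - q\<bar> < e \<longrightarrow> q' \<in> C" if "q \<in> C" for q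
    using *[of q] that \<open>C \<subseteq> \<rat>\<close> by (metis subsetD)
  moreover have "\<exists>e>0. \<forall>q'\<in>\<rat>. \<bar>q' - q\<bar> < e \<longrightarrow> q' \<in> \<rat> - C" if "q \<in> \<rat> - C" for q
    using *[of q] that by (metis Diff_iff)
  ultimately show ?thesis
    unfolding S_2_def openin_euclidean_subtopology_iff dist_real_def using \<open>C \<subseteq> \<rat>\<close> by simp
qed

lemma sqrt_2_irrational: "sqrt 2 \<notin> \<rat>"
proof
  assume "sqrt 2 \<in> \<rat>"
  then obtain m n :: nat where mn: "n \<noteq> 0" "\<bar>sqrt 2\<bar> = real m / real n" "coprime m n"
    by (rule Rats_abs_nat_div_natE)
  then have "real m = sqrt 2 * real n" by (simp add: field_simps)
  then have "real (m\<^sup>2) = real (2 * n\<^sup>2)" by (simp add: power_mult_distrib)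
  then have eq: "m\<^sup>2 = 2 * n\<^sup>2" by (simp only: of_nat_eq_iff)
  then have "even (m\<^sup>2)" by simp
  then have "even m" by simp
  then obtain k where k: "m = 2 * k" by (rule evenE)
  with eq have "n\<^sup>2 = 2 * k\<^sup>2" by (simp add: power_mult_distrib)
  then have "even (n\<^sup>2)" by simp
  then have "even n" by simp
  with \<open>even m\<close> mn(3) show False using coprime_common_divisor_nat[of m n 2] by auto
qed

lemma sqrt_2_div_not_Ints:
  assumes "d \<in> \<rat>" "d \<noteq> 0"
  shows "sqrt 2 / d \<notin> \<int>"
proof
  assume "sqrt 2 / d \<in> \<int>"
  then have "sqrt 2 / d \<in> \<rat>" using Ints_subset_Rats by blast
  then have "sqrt 2 / d * d \<in> \<rat>" using assms(1) by (rule Rats_mult)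
  then show False using assms(2) sqrt_2_irrational by simp
qed

text \<open>Cut \<open>C - {r}\<close> into the level sets of \<open>\<lfloor>sqrt 2 / \<bar>q - r\<bar>\<rfloor>\<close>: the argument of the floor is
  irrational at every rational \<open>q \<noteq> r\<close>, so the level sets are clopen.\<close>

lemma clopen_rat_partition:
  assumes C: "clopen_rat C" and r: "r \<in> C"
  shows "\<exists>D. (\<forall>n::nat. D n \<noteq> {} \<and> clopen_rat (D n)) \<and> (\<Union>n. D n) = C - {r} \<and>
    (\<forall>m n. m \<noteq> n \<longrightarrow> D m \<inter> D n = {}) \<and> (\<forall>e>0. \<exists>N. \<forall>n\<ge>N. \<forall>q\<in>D n. \<bar>q - r\<bar> < e)"
proof -
  define lev where "lev q = nat \<lfloor>sqrt 2 / \<bar>q - r\<bar>\<rfloor>" for q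
  \<comment> \<open>Enumerating the attained levels skips the empty ones, so every
    \<open>D n\<close> is nonempty.\<close>
  define L where "L = lev ` (C - {r})"
  define D where "D n = {q \<in> C - {r}. lev q = enumerate L n}" for n
  have rQ: "r \<in> \<rat>" and CQ: "C \<subseteq> \<rat>" using C r unfolding clopen_rat_def by auto
  have le_lev: "n \<le> lev q \<longleftrightarrow> real n * \<bar>q - r\<bar> \<le> sqrt 2" if "q \<noteq> r" for n q
  proof -
    have "n \<le> lev q \<longleftrightarrow> real n \<le> sqrt 2 / \<bar>q - r\<bar>"
      unfolding lev_def using le_nat_floor[of n] by (simp add: le_nat_iff le_floor_iff nat_le_iff)
    also have "\<dots> \<longleftrightarrow> real n * \<bar>q - r\<bar> \<le> sqrt 2"
      using that by (simp add: pos_le_divide_eq)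
    finally show ?thesis .
  qed
  \<comment> \<open>The clopen set \<open>C\<close> contains rationals arbitrarily close to
    \<open>r\<close>, and these have arbitrarily high levels.\<close>
  have "\<exists>l\<in>L. n < l" for n
  proof -
    obtain e where e: "e > 0" "\<forall>q'\<in>\<rat>. \<bar>q' - r\<bar> < e \<longrightarrow> (q' \<in> C \<longleftrightarrow> r \<in> C)"
      using C rQ unfolding clopen_rat_def by blast
    have "0 < min e (1 / real (Suc n))" using e(1) by simp
    then obtain d where d: "d \<in> \<rat>" "0 < d" "d < min e (1 / real (Suc n))"
      using Rats_dense_in_real by blast
    have rd: "r + d \<in> C" using e(2) d rQ r Rats_add by simp
    have "real (Suc n) * d \<le> 1" using d(3) by (simp add: field_simps)
    moreover have "(1::real) \<le> sqrt 2" by simp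
    moreover have "real (Suc n) * \<bar>r + d - r\<bar> = real (Suc n) * d" using d(2) by simp
    ultimately have "real (Suc n) * \<bar>r + d - r\<bar> \<le> sqrt 2" by linarith
    then have "Suc n \<le> lev (r + d)" using le_lev[of "r + d" "Suc n"] d(2) by simp
    then show ?thesis unfolding L_def using d(2) rd by (intro bexI[of _ "lev (r + d)"]) auto
  qed
  then have inf: "infinite L" unfolding infinite_nat_iff_unbounded by blast
  have "D n \<noteq> {}" for n
    using enumerate_in_set[OF inf, of n] unfolding D_def L_def by auto
  moreover have "clopen_rat (D n)" for n
    unfolding clopen_rat_def
  proof (intro conjI ballI)
    show "D n \<subseteq> \<rat>" using CQ unfolding D_def by auto
    fix q :: real assume q: "q \<in> \<rat>"
    show "\<exists>e>0. \<forall>q'\<in>\<rat>. \<bar>q' - q\<bar> < e \<longrightarrow> (q' \<in> D n \<longleftrightarrow> q \<in> D n)"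
    proof (cases "q = r")
      case True
      \<comment> \<open>Closer to \<open>r\<close> than this, the level exceeds that of
        \<open>D n\<close>.\<close>
      define e where "e = sqrt 2 / real (Suc (enumerate L n))"
      have "q' \<notin> D n" if "\<bar>q' - r\<bar> < e" for q'
      proof
        assume "q' \<in> D n"
        then have q': "q' \<noteq> r" "lev q' = enumerate L n" unfolding D_def by auto
        have "real (Suc (enumerate L n)) * \<bar>q' - r\<bar> \<le> sqrt 2"
          using that unfolding e_def by (simp add: field_simps)
        with q' le_lev[of q' "Suc (enumerate L n)"] show False by simp
      qed
      moreover have "r \<notin> D n" "e > 0" unfolding D_def e_def by auto
      ultimately show ?thesis using True by blast
    next
      case False
      obtain e1 where e1: "e1 > 0" "\<forall>q'\<in>\<rat>. \<bar>q' - q\<bar> < e1 \<longrightarrow> (q' \<in> C \<longleftrightarrow> q \<in> C)"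
        using C q unfolding clopen_rat_def by blast
      have "((\<lambda>q'. sqrt 2 / \<bar>q' - r\<bar>) \<longlongrightarrow> sqrt 2 / \<bar>q - r\<bar>) (at q)"
        using False by (intro tendsto_intros) auto
      moreover have "sqrt 2 / \<bar>q - r\<bar> \<notin> \<int>"
        using False q rQ by (intro sqrt_2_div_not_Ints) (auto simp: Rats_diff)
      ultimately have "\<forall>\<^sub>F q' in at q. \<lfloor>sqrt 2 / \<bar>q' - r\<bar>\<rfloor> = \<lfloor>sqrt 2 / \<bar>q - r\<bar>\<rfloor>"
        by (rule eventually_floor_eq)
      then obtain e2 where e2: "e2 > 0"
        "\<And>q'. q' \<noteq> q \<Longrightarrow> \<bar>q' - q\<bar> < e2 \<Longrightarrow> \<lfloor>sqrt 2 / \<bar>q' - r\<bar>\<rfloor> = \<lfloor>sqrt 2 / \<bar>q - r\<bar>\<rfloor>"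
        unfolding eventually_at by (auto simp: dist_real_def)
      \<comment> \<open>The bound \<open>\<bar>q - r\<bar>\<close> keeps \<open>q'\<close> away from
        \<open>r\<close>.\<close>
      define e where "e = min (min e1 e2) \<bar>q - r\<bar>"
      have "e > 0" unfolding e_def using e1 e2 False by simp
      moreover have "q' \<in> D n \<longleftrightarrow> q \<in> D n" if "q' \<in> \<rat>" "\<bar>q' - q\<bar> < e" for q'
      proof -
        have "lev q' = lev q" using e2(2)[of q'] that(2) unfolding lev_def e_def by fastforce
        moreover have "q' \<in> C \<longleftrightarrow> q \<in> C" using e1(2) that unfolding e_def by simp
        moreover have "q' \<noteq> r" using that(2) unfolding e_def by auto
        ultimately show ?thesis using False unfolding D_def by simp
      qed
      ultimately show ?thesis by blast
    qed
  qed
  moreover have "(\<Union>n. D n) = C - {r}"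
  proof -
    have "\<exists>n. q \<in> D n" if q: "q \<in> C - {r}" for q
    proof -
      have "lev q \<in> L" using q unfolding L_def by blast
      then obtain n where "enumerate L n = lev q" using enumerate_Ex[OF inf] by blast
      then have "q \<in> D n" using q by (simp add: D_def)
      then show ?thesis ..
    qed
    moreover have "D n \<subseteq> C - {r}" for n unfolding D_def by blast
    ultimately show ?thesis by blast
  qed
  moreover have "D m \<inter> D n = {}" if "m \<noteq> n" for m n
    using that strict_mono_enumerate[OF inf] unfolding D_def
    by (auto simp: strict_mono_eq)
  moreover have "\<exists>N. \<forall>n\<ge>N. \<forall>q\<in>D n. \<bar>q - r\<bar> < e" if "e > 0" for e
  proof -
    obtain N where N: "sqrt 2 / e < real N" using reals_Archimedean2 by blast
    have "\<bar>q - r\<bar> < e" if "N \<le> n" "q \<in> D n" for n q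
    proof -
      have q: "q \<noteq> r" "lev q = enumerate L n" using that(2) unfolding D_def by auto
      have "N \<le> lev q" using q(2) that(1) le_enumerate[OF inf, of n] by simp
      then have "real N * \<bar>q - r\<bar> \<le> sqrt 2" using le_lev[OF q(1)] by blast
      also have "\<dots> < real N * e" using N \<open>e > 0\<close> by (simp add: field_simps)
      finally show ?thesis using N \<open>e > 0\<close>
        by (simp add: mult_less_cancel_left_disj)
    qed
    then show ?thesis by blast
  qed
  ultimately show ?thesis by (intro exI[of _ D]) blast
qed

text \<open>The rationals are cut into a tree of clopen cells: each cell gives up its root, and the
  rest is partitioned into cells that shrink to the root. The root is the element that comes first
  in a fixed enumeration \<open>e\<close>; this choice makes every rational the root of some
  cell.\<close>

lemma tree_topology_homeomorphic_S_2: "tree_topology homeomorphic_space S_2"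
proof -
  define e where "e = to_nat_on (\<rat> :: real set)"
  have e: "inj_on e \<rat>" unfolding e_def by (rule inj_on_to_nat_on[OF countable_rat])
  define good where "good C \<longleftrightarrow> C \<noteq> {} \<and> clopen_rat C" for C
  have "\<exists>r. r \<in> C \<and> (\<forall>q\<in>C. e r \<le> e q)" if "good C" for C
  proof -
    obtain q where "q \<in> C" using \<open>good C\<close> good_def by blast
    then show ?thesis using ex_has_least_nat[of "\<lambda>q. q \<in> C" q e] by blast
  qed
  then obtain root where root: "\<And>C. good C \<Longrightarrow> root C \<in> C"
    "\<And>C q. good C \<Longrightarrow> q \<in> C \<Longrightarrow> e (root C) \<le> e q" by metis
  have "\<exists>D. (\<forall>n::nat. good (D n)) \<and> (\<Union>n. D n) = C - {root C} \<and>
    (\<forall>m n. m \<noteq> n \<longrightarrow> D m \<inter> D n = {}) \<and> (\<forall>\<epsilon>>0. \<exists>N. \<forall>n\<ge>N. \<forall>q\<in>D n. \<bar>q - root C\<bar> < \<epsilon>)"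
    if "good C" for C
    using clopen_rat_partition[of C "root C"] root(1)[OF that] that unfolding good_def by blast
  then obtain D :: "real set \<Rightarrow> nat \<Rightarrow> real set" where D:
    "\<And>C. good C \<Longrightarrow> (\<forall>n. good (D C n)) \<and> (\<Union>n. D C n) = C - {root C} \<and>
    (\<forall>m n. m \<noteq> n \<longrightarrow> D C m \<inter> D C n = {}) \<and> (\<forall>\<epsilon>>0. \<exists>N. \<forall>n\<ge>N. \<forall>q\<in>D C n. \<bar>q - root C\<bar> < \<epsilon>)"
    by metis
  define cell where "cell = foldl D \<rat>"
  define f where "f s = root (cell s)" for s
  have cell_simps: "cell [] = \<rat>" "cell (s @ [n]) = D (cell s) n" for s n by (simp_all add: cell_def)
  have "(\<rat> :: real set) \<noteq> {}" using Rats_0 by blast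
  then have "good \<rat>" unfolding good_def clopen_rat_def by (auto intro: exI[of _ 1])
  have good: "good (cell s)" for s
    by (induction s rule: rev_induct) (use \<open>good \<rat>\<close> D cell_simps in auto)
  have cellQ: "cell s \<subseteq> \<rat>" for s using good unfolding good_def clopen_rat_def by blast
  have cell_sub: "cell (s @ t) \<subseteq> cell s" for s t
  proof (induction t rule: rev_induct)
    case (snoc n t)
    have "cell ((s @ t) @ [n]) \<subseteq> cell (s @ t)" unfolding cell_simps using D[OF good] by blast
    with snoc show ?case by simp
  qed simp
  have cell_child: "cell (s @ n # t) \<subseteq> D (cell s) n" for s n t
    using cell_sub[of "s @ [n]" t] cell_simps by simp
  have f_in: "f s \<in> cell s" for s unfolding f_def by (rule root(1)[OF good])
  have f_cell: "f q \<in> cell p \<longleftrightarrow> prefix p q" for p q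
  proof
    assume fq: "f q \<in> cell p"
    show "prefix p q"
    proof (cases rule: prefix_cases[of p q])
      case 2
      then obtain n t where "p = q @ n # t" by (rule strict_prefixE')
      then have "f q \<in> D (cell q) n" using cell_child fq by blast
      then show ?thesis using D[OF good, of q] unfolding f_def by blast
    next
      case 3
      then obtain u m s n t where *: "m \<noteq> n" "p = u @ m # s" "q = u @ n # t"
        using parallel_decomp by blast
      then have "f q \<in> D (cell u) m" "f q \<in> D (cell u) n"
        using cell_child fq f_in[of q] by blast+
      then show ?thesis using D[OF good, of u] * by blast
    qed
  next
    assume "prefix p q"
    then show "f q \<in> cell p" using f_in cell_sub by (auto simp: prefix_def)
  qed
  have inj: "inj f"
    by (rule injI) (metis f_cell f_in prefix_order.antisym)
  have surj: "range f = \<rat>"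
  proof
    show "range f \<subseteq> \<rat>" using f_in cellQ by blast
    show "\<rat> \<subseteq> range f"
    proof
      fix q :: real assume q: "q \<in> \<rat>"
      show "q \<in> range f"
      proof (rule ccontr)
        assume neg: "q \<notin> range f"
        have step: "\<exists>n. q \<in> cell (s @ [n])" if "q \<in> cell s" for s
        proof -
          have "q \<noteq> f s" using neg by blast
          then have "q \<in> (\<Union>n. D (cell s) n)" using that D[OF good, of s] unfolding f_def by simp
          then show ?thesis unfolding cell_simps by blast
        qed
        have "\<exists>s. q \<in> cell s \<and> length s = n" for n
        proof (induction n)
          case 0
          show ?case using q cell_simps by auto
        next
          case (Suc n)
          then obtain s where "q \<in> cell s" "length s = n" by blast
          moreover from this obtain k where "q \<in> cell (s @ [k])" using step by blast
          ultimately show ?case by (intro exI[of _ "s @ [k]"]) simp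
        qed
        then obtain p where p: "\<And>n. q \<in> cell (p n)" "\<And>n. length (p n) = n" by metis
        \<comment> \<open>A rational \<open>q\<close> that is never a root would lie in cells at all
          depths, whose roots are distinct and none of which comes after \<open>q\<close> in the
          enumeration.\<close>
        have "inj (\<lambda>n. e (f (p n)))"
        proof (rule injI)
          fix m n assume "e (f (p m)) = e (f (p n))"
          then have "f (p m) = f (p n)" using inj_onD[OF e] f_in cellQ by blast
          then show "m = n" using inj p(2) by (metis injD)
        qed
        moreover have "range (\<lambda>n. e (f (p n))) \<subseteq> {..e q}"
          using root(2)[OF good p(1)] unfolding f_def by auto
        ultimately show False
          using finite_subset[OF _ finite_atMost] range_inj_infinite by blast
      qed
    qed
  qed
  have "homeomorphic_maps tree_topology S_2 f (inv f)"
    unfolding homeomorphic_maps_def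
  proof (intro conjI ballI)
    have "openin tree_topology {s. f s \<in> T}" if T: "openin S_2 T" for T
    proof (rule openin_treeI)
      fix s assume "s \<in> {s. f s \<in> T}"
      then obtain \<epsilon> where \<epsilon>: "\<epsilon> > 0" "\<forall>q\<in>\<rat>. dist q (f s) < \<epsilon> \<longrightarrow> q \<in> T"
        using T unfolding S_2_def openin_euclidean_subtopology_iff by blast
      obtain N where N: "\<forall>n\<ge>N. \<forall>q\<in>D (cell s) n. \<bar>q - f s\<bar> < \<epsilon>"
        using D[OF good, of s, THEN conjunct2, THEN conjunct2, THEN conjunct2, rule_format, OF \<epsilon>(1)]
        unfolding f_def by blast
      have "f (s @ n # t) \<in> T" if "N \<le> n" for n t
      proof -
        have "f (s @ n # t) \<in> D (cell s) n" using f_in cell_child by blast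
        then have "\<bar>f (s @ n # t) - f s\<bar> < \<epsilon>" using N that by blast
        moreover have "f (s @ n # t) \<in> \<rat>" using surj by blast
        ultimately show ?thesis using \<epsilon>(2) by (simp add: dist_real_def)
      qed
      then show "\<exists>N. \<forall>n\<ge>N. \<forall>t. s @ n # t \<in> {s. f s \<in> T}" by blast
    qed
    then show "continuous_map tree_topology S_2 f"
      unfolding continuous_map_def using surj by (auto simp: S_2_def)
    have top: "topspace S_2 = \<rat>" by (simp add: S_2_def)
    have inv_f: "prefix p (inv f q) \<longleftrightarrow> q \<in> cell p" if "q \<in> \<rat>" for p q
      using f_cell[of "inv f q" p] surj that by (simp add: f_inv_into_f)
    show "continuous_map S_2 tree_topology (inv f)"
      unfolding tree_topology_def
    proof (rule continuous_on_generated_topo)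
      fix U :: "nat list set" assume "U \<in> {{q. prefix p q} | p. True} \<union> {- {q. prefix p q} | p. True}"
      then obtain p where "U = {q. prefix p q} \<or> U = - {q. prefix p q}" by blast
      moreover have "inv f -` {q. prefix p q} \<inter> topspace S_2 = cell p"
        "inv f -` (- {q. prefix p q}) \<inter> topspace S_2 = \<rat> - cell p"
        using subsetD[OF cellQ[of p]] unfolding top by (auto simp: inv_f)
      ultimately have "inv f -` U \<inter> topspace S_2 = cell p \<or> inv f -` U \<inter> topspace S_2 = \<rat> - cell p"
        by metis
      then show "openin S_2 (inv f -` U \<inter> topspace S_2)"
        using clopen_rat_openin[of "cell p"] good[of p] unfolding good_def by auto
    next
      show "inv f ` topspace S_2 \<subseteq> \<Union>({{q. prefix p q} | p. True} \<union> {- {q. prefix p q} | p. True})"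
        by blast
    qed
    fix q assume "q \<in> topspace S_2"
    then show "f (inv f q) = q" using surj top by (simp add: f_inv_into_f)
  qed (use inj in auto)
  then show ?thesis unfolding homeomorphic_space_def by blast
qed

section \<open>Schemes yielding the rationals or \<open>S_0\<close>\<close>

text \<open>The aim is a finite set \<open>F p\<close> contained in exactly the points above
  \<open>p\<close>. Elements \<open>k\<close> of a child subtree that are missing from the parent
  come from \<open>up\<close>; elements \<open>j\<close> of the parent that are missing from a child
  subtree come from \<open>sep\<close>. By convergence \<open>k\<close> is lost in late siblings and
  \<open>j\<close> is present in them. After sparsening, the \<open>k\<close> of child
  \<open>n\<close> excludes the parent and the later siblings, and the \<open>j\<close> with
  \<open>m < n\<close> exclude the earlier ones.\<close>

lemma (in scheme) canonical_S_2:
  assumes sep: "\<And>s n. \<exists>k\<in>x s. \<forall>t. k \<notin> x (s @ n # t)"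
    and up: "\<And>s n t. \<not> x (s @ n # t) \<subseteq> a s"
  shows "has_canonical X"
proof -
  obtain k1 where k1: "\<And>s n. k1 s n \<in> x s" "\<And>s n t. k1 s n \<notin> x (s @ n # t)"
    using sep by metis
  have "\<exists>k. k \<in> x (s @ [n]) \<and> k \<notin> a s" for s n using up[of s n "[]"] by blast
  then obtain k2 where k2: "\<And>s n. k2 s n \<in> x (s @ [n])" "\<And>s n. k2 s n \<notin> a s" by metis
  obtain M where M: "\<And>s n c t. M s n \<le> c \<Longrightarrow> k2 s n \<notin> x (s @ c # t)"
    using eventually_not_mem[OF k2(2)] by metis
  have "k1 s n \<in> a s" for s n using k1(1) below by blast
  then have "\<exists>N. \<forall>c\<ge>N. \<forall>t. k1 s n \<in> x (s @ c # t)" for s n by (rule eventually_mem)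
  then obtain N where N: "\<And>s n c t. N s n \<le> c \<Longrightarrow> k1 s n \<in> x (s @ c # t)"
    by metis
  have "k2 s n \<in> a (s @ [n])" for s n using k2(1) below by blast
  then have "\<exists>D. \<forall>c\<ge>D. \<forall>t. k2 s n \<in> x ((s @ [n]) @ c # t)" for s n by (rule eventually_mem)
  then obtain D where D: "\<And>s n c t. D s n \<le> c \<Longrightarrow> k2 s n \<in> x ((s @ [n]) @ c # t)"
    by metis
  \<comment> \<open>\<open>D (butlast r) (last r)\<close> belongs to the edge leading into
    \<open>r\<close>: starting the children of \<open>r\<close> there keeps the element
    \<open>k2\<close> of this edge in the whole new subtree above \<open>r\<close>. For
    \<open>r = []\<close> the value is arbitrary and harmless.\<close>
  have "\<exists>g :: nat \<Rightarrow> nat. strict_mono g \<and> D (butlast r) (last r) \<le> g 0 \<and>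
      (\<forall>m n. m < n \<longrightarrow> max (M r (g m)) (N r (g m)) \<le> g n)" for r
    using exists_sparse_seq[of "D (butlast r) (last r)" "\<lambda>c. max (M r c) (N r c)"] by blast
  then obtain g :: "nat list \<Rightarrow> nat \<Rightarrow> nat" where g: "\<And>r. strict_mono (g r)"
    "\<And>r. D (butlast r) (last r) \<le> g r 0"
    "\<And>r m n. m < n \<Longrightarrow> max (M r (g r m)) (N r (g r m)) \<le> g r n"
    by metis
  define \<phi> where "\<phi> = foldl (\<lambda>r n. r @ [g r n]) []"
  have \<phi>: "\<phi> (s @ [n]) = \<phi> s @ [g (\<phi> s) n]" for s n by (simp add: \<phi>_def)
  have th: "thinning \<phi>"
    unfolding thinning_def using \<phi> strict_mono_imp_increasing[OF g(1)] by blast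
  interpret th: scheme X "\<lambda>s. x (\<phi> s)" "\<lambda>s. a (\<phi> s)" by (rule thin[OF th])
  have child: "\<exists>u. \<phi> (s @ n # t) = \<phi> s @ g (\<phi> s) n # u" for s n t
    using thinning_prefix[OF th, of "s @ [n]" t] \<phi> by auto
  define k where "k s n = k2 (\<phi> s) (g (\<phi> s) n)" for s n
  define j where "j s n = k1 (\<phi> s) (g (\<phi> s) n)" for s n
  have k_in: "k s n \<in> x (\<phi> (s @ n # t))" for s n t
  proof (cases t)
    case Nil
    then show ?thesis using k2(1) \<phi> by (simp add: k_def)
  next
    case (Cons m t')
    obtain u where u: "\<phi> ((s @ [n]) @ m # t') = \<phi> (s @ [n]) @ g (\<phi> (s @ [n])) m # u"
      using child by blast
    have "D (\<phi> s) (g (\<phi> s) n) \<le> g (\<phi> (s @ [n])) 0"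
      using g(2)[of "\<phi> (s @ [n])"] \<phi> by simp
    also have "\<dots> \<le> g (\<phi> (s @ [n])) m" using g(1) by (simp add: strict_mono_less_eq)
    finally show ?thesis using D u Cons \<phi> by (simp add: k_def)
  qed
  have k_notin: "k s n \<notin> x (\<phi> s)" for s n using k2(2) below by (auto simp: k_def)
  have k_notin': "k s n \<notin> x (\<phi> (s @ m # t))" if "n < m" for s n m t
  proof -
    obtain u where "\<phi> (s @ m # t) = \<phi> s @ g (\<phi> s) m # u" using child by blast
    then show ?thesis using M g(3)[OF that, of "\<phi> s"] by (simp add: k_def)
  qed
  have j_in: "j s n \<in> x (\<phi> s)" for s n using k1(1) by (simp add: j_def)
  have j_in': "j s m \<in> x (\<phi> (s @ n # t))" if "m < n" for s n m t
  proof -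
    obtain u where "\<phi> (s @ n # t) = \<phi> s @ g (\<phi> s) n # u" using child by blast
    then show ?thesis using N g(3)[OF that, of "\<phi> s"] by (simp add: j_def)
  qed
  have j_notin: "j s n \<notin> x (\<phi> (s @ n # t))" for s n t
  proof -
    obtain u where "\<phi> (s @ n # t) = \<phi> s @ g (\<phi> s) n # u" using child by blast
    then show ?thesis using k1(2) by (simp add: j_def)
  qed
  have "\<exists>F. finite F \<and> (\<forall>t. F \<subseteq> x (\<phi> t) \<longleftrightarrow> prefix p t)" for p
  proof (induction p rule: rev_induct)
    case Nil
    show ?case by (intro exI[of _ "{}"]) simp
  next
    case (snoc n p)
    then obtain F where F: "finite F" "\<And>t. F \<subseteq> x (\<phi> t) \<longleftrightarrow> prefix p t" by blast
    define G where "G = insert (k p n) (F \<union> j p ` {..<n})"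
    have "finite G" using F(1) by (simp add: G_def)
    moreover have "G \<subseteq> x (\<phi> t) \<longleftrightarrow> prefix (p @ [n]) t" for t
    proof
      assume G: "G \<subseteq> x (\<phi> t)"
      then obtain u where u: "t = p @ u" using F(2)[of t] by (auto simp: G_def prefix_def)
      show "prefix (p @ [n]) t"
      proof (cases u)
        case Nil
        then show ?thesis using G u k_notin[of p n] by (auto simp: G_def)
      next
        case (Cons m u')
        have "\<not> n < m" using G u Cons k_notin'[of n m p u'] by (auto simp: G_def)
        moreover have "\<not> m < n" using G u Cons j_notin[of p m u'] by (auto simp: G_def)
        ultimately show ?thesis using u Cons by simp
      qed
    next
      assume "prefix (p @ [n]) t"
      then obtain u where u: "t = p @ n # u" by (auto simp: prefix_def)
      then have "F \<subseteq> x (\<phi> t)" using F(2) by simp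
      then show "G \<subseteq> x (\<phi> t)" using u k_in j_in' by (auto simp: G_def)
    qed
    ultimately show ?case by blast
  qed
  then obtain F where F: "\<And>p. finite (F p)" "\<And>p t. F p \<subseteq> x (\<phi> t) \<longleftrightarrow> prefix p t" by metis
  have "subtopology scott_powerset (range (\<lambda>s. x (\<phi> s))) homeomorphic_space tree_topology"
  proof (rule homeomorphic_scott_range)
    show "inj (\<lambda>s. x (\<phi> s))"
      by (rule injI) (metis F(2) prefix_order.antisym prefix_order.refl)
    show "openin tree_topology {t. k \<in> x (\<phi> t)}" for k
    proof (rule openin_treeI)
      fix s assume "s \<in> {t. k \<in> x (\<phi> t)}"
      then have "k \<in> a (\<phi> s)" using below by blast
      then show "\<exists>N. \<forall>n\<ge>N. \<forall>t. s @ n # t \<in> {t. k \<in> x (\<phi> t)}"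
        using th.eventually_mem by simp
    qed
    show "\<exists>F. finite F \<and> F \<subseteq> x (\<phi> t) \<and> (\<forall>t'. F \<subseteq> x (\<phi> t') \<longrightarrow> t' \<in> U)"
      if "openin tree_topology U" "t \<in> U" for U t
    proof (rule generated_nbhd[OF _ that[unfolded tree_topology_def]])
      fix U :: "nat list set" and t
      assume U: "U \<in> {{q. prefix p q} | p. True} \<union> {- {q. prefix p q} | p. True}" and t: "t \<in> U"
      from U consider p where "U = {q. prefix p q}" | p where "U = - {q. prefix p q}" by blast
      then show "\<exists>F. finite F \<and> F \<subseteq> x (\<phi> t) \<and> (\<forall>t'. F \<subseteq> x (\<phi> t') \<longrightarrow> t' \<in> U)"
      proof cases
        case 1
        then show ?thesis using F t by (intro exI[of _ "F p"]) simp
      next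
        case 2
        show ?thesis
        proof (cases rule: prefix_cases[of p t])
          case a: 1
          then show ?thesis using t 2 by simp
        next
          case b: 2
          then obtain n u where p: "p = t @ n # u" by (rule strict_prefixE')
          have "j t n \<notin> x (\<phi> t')" if "prefix p t'" for t'
            using that p j_notin[of t n] by (auto simp: prefix_def)
          then show ?thesis using 2 j_in[of t n] by (intro exI[of _ "{j t n}"]) auto
        next
          case c: 3
          have "\<not> prefix p t'" if "prefix t t'" for t'
            using c that prefix_same_cases by blast
          then show ?thesis using 2 F by (intro exI[of _ "F t"]) simp
        qed
      qed
    qed
  qed simp
  then have "subtopology scott_powerset (range (\<lambda>s. x (\<phi> s))) homeomorphic_space S_2"
    using tree_topology_homeomorphic_S_2 homeomorphic_space_trans by blast
  then show ?thesis using has_canonicalI[OF th.range_closed] by blast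
qed

section \<open>Codes of nodes and copies of S_0\<close>

definition list_code :: "nat list \<Rightarrow> nat" where
  "list_code s = list_encode (rev s)"

lemma list_code_eq_iff: "list_code s = list_code t \<longleftrightarrow> s = t"
  using inj_list_encode[of UNIV] by (auto simp: list_code_def dest: injD)

text \<open>The reversal in \<open>list_code\<close> puts the last entry outermost in the code, so a
  node is coded after its parent.\<close>

lemma list_code_snoc: "list_code s < list_code (s @ [n])"
  using le_prod_encode_2[of "list_encode (rev s)" n] by (simp add: list_code_def less_Suc_eq_le)

lemma list_code_Nil [simp]: "list_code [] = 0"
  by (simp add: list_code_def)

lemma finite_list_code_less: "finite {s. list_code s < m}"
proof (rule finite_imageD)
  show "finite (list_code ` {s. list_code s < m})"
    by (rule finite_subset[of _ "{..<m}"]) auto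
  show "inj_on list_code {s. list_code s < m}" by (simp add: inj_on_def list_code_eq_iff)
qed

lemma openin_S_0_cocone: "openin S_0 (- {q. prefix p q})"
  unfolding S_0_def by (rule topology_generated_by_Basis) blast

text \<open>If \<open>k\<close> lies in \<open>x s\<close>, it lies in \<open>x r\<close> for each
  prefix \<open>r\<close> of \<open>s\<close> and hence in all but finitely many subtrees branching
  off at \<open>r\<close>; removing the exceptional cones leaves an \<open>S_0\<close>-neighbourhood
  of \<open>s\<close>. Conversely, an element missing from \<open>x p\<close> is missing from the
  whole cone of \<open>p\<close>.\<close>

lemma (in scheme) canonical_S_0_embedding:
  assumes top: "\<And>s. a s = x s" and mono: "\<And>s t. prefix s t \<Longrightarrow> x t \<subseteq> x s"
    and refl: "\<And>s t. x s \<subseteq> x t \<Longrightarrow> prefix t s"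
  shows "has_canonical X"
proof -
  have "subtopology scott_powerset (range x) homeomorphic_space S_0"
  proof (rule homeomorphic_scott_range)
    show "inj x" by (rule injI) (metis order_refl prefix_order.antisym refl)
    show "openin S_0 {t. k \<in> x t}" for k
    proof (subst openin_subopen, intro ballI)
      fix s assume s: "s \<in> {t. k \<in> x t}"
      have "k \<in> a r" if "prefix r s" for r using mono[OF that] s top by auto
      then have "\<forall>r. \<exists>N. prefix r s \<longrightarrow> (\<forall>n\<ge>N. \<forall>t. k \<in> x (r @ n # t))"
        using eventually_mem by blast
      then obtain N where N: "\<And>r n t. prefix r s \<Longrightarrow> N r \<le> n \<Longrightarrow> k \<in> x (r @ n # t)" by metis
      \<comment> \<open>The exceptional cones off the path to \<open>s\<close>, those of children of
        \<open>s\<close> included.\<close>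
      define G where "G = {r @ [n] | r n. prefix r s \<and> n < N r \<and> \<not> prefix (r @ [n]) s}"
      have "G \<subseteq> (\<lambda>(r, n). r @ [n]) ` (SIGMA r : set (prefixes s). {..<N r})"
        unfolding G_def by force
      then have fin: "finite G" by (rule finite_subset) auto
      define W where "W = (\<Inter>p\<in>G. - {q. prefix p q}) \<inter> topspace S_0"
      have "openin S_0 W"
        unfolding W_def using fin openin_S_0_cocone by (intro openin_INT) auto
      moreover have "s \<in> W" unfolding W_def G_def by auto
      moreover have "W \<subseteq> {t. k \<in> x t}"
      proof
        fix t assume t: "t \<in> W"
        have out: "k \<in> x (r @ n # u)" if "prefix r s" "t = r @ n # u" "\<not> prefix (r @ [n]) s" for r n u
        proof (rule N[OF that(1)])
          have "prefix (r @ [n]) t" using that(2) by simp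
          then have "r @ [n] \<notin> G" using t unfolding W_def by blast
          then show "N r \<le> n" using that(1,3) unfolding G_def by fastforce
        qed
        show "t \<in> {t. k \<in> x t}"
        proof (cases rule: prefix_cases[of t s])
          case 1
          then show ?thesis using mono[OF 1] s by auto
        next
          case 2
          then obtain n u where tu: "t = s @ n # u" by (rule strict_prefixE')
          then show ?thesis using out[of s n u] by simp
        next
          case 3
          then obtain r m v n u where *: "m \<noteq> n" "t = r @ m # v" "s = r @ n # u"
            using parallel_decomp by blast
          then show ?thesis using out[of r m v] by simp
        qed
      qed
      ultimately show "\<exists>T. openin S_0 T \<and> s \<in> T \<and> T \<subseteq> {t. k \<in> x t}" by blast
    qed
    show "\<exists>F. finite F \<and> F \<subseteq> x t \<and> (\<forall>t'. F \<subseteq> x t' \<longrightarrow> t' \<in> U)" if "openin S_0 U" "t \<in> U" for U t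
    proof (rule generated_nbhd[OF _ that[unfolded S_0_def]])
      fix U :: "nat list set" and t
      assume "U \<in> {- {q. prefix p q} |p. True}" and t: "t \<in> U"
      then obtain p where p: "U = - {q. prefix p q}" by blast
      with t have "\<not> x t \<subseteq> x p" using refl by blast
      then obtain k where k: "k \<in> x t" "k \<notin> x p" by blast
      have "\<not> prefix p t'" if "k \<in> x t'" for t' using mono k(2) that by blast
      then show "\<exists>F. finite F \<and> F \<subseteq> x t \<and> (\<forall>t'. F \<subseteq> x t' \<longrightarrow> t' \<in> U)"
        using p k(1) by (intro exI[of _ "{k}"]) auto
    qed
  qed simp
  then show ?thesis using has_canonicalI[OF range_closed] by blast
qed

text \<open>The new tree is built node by node along \<open>list_code\<close>, keeping the points chosen so far incomparable
  unless one node extends the other; \<open>avoid\<close> is what makes the next choice possible.\<close>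

lemma (in scheme) canonical_S_0_avoiding:
  assumes top: "\<And>s. a s = x s"
    and sep: "\<And>s n. \<exists>k\<in>x s. \<forall>t. k \<notin> x (s @ n # t)"
    and mono: "\<And>s t. prefix s t \<Longrightarrow> x t \<subseteq> x s"
    and avoid: "\<And>s R N. finite R \<Longrightarrow> (\<And>r. r \<in> R \<Longrightarrow> strict_prefix s r) \<Longrightarrow>
      \<exists>n\<ge>N. \<exists>t. \<forall>r\<in>R. \<not> x r \<subseteq> x (s @ n # t)"
  shows "has_canonical X"
proof -
  have strict: "\<not> x s \<subseteq> x t" if st: "strict_prefix s t" for s t
  proof -
    obtain n u where "t = s @ n # u" using st by (rule strict_prefixE')
    then show ?thesis using sep by blast
  qed
  \<comment> \<open>The requirement at \<open>t\<close> consults \<open>f\<close> only at the parent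
    of \<open>t\<close> and at nodes of smaller code, so recursion along \<open>list_code\<close>
    applies. At the root it is void.\<close>
  define P where "P f t r \<longleftrightarrow> (\<forall>s n. t = s @ [n] \<longrightarrow> (\<exists>c\<ge>n. \<exists>u. r = f s @ c # u) \<and>
      (\<forall>q. list_code q < list_code t \<longrightarrow> \<not> prefix q s \<longrightarrow>
        \<not> x (f q) \<subseteq> x r \<and> \<not> x r \<subseteq> x (f q)))" for f t r
  have "\<exists>f. \<forall>t. P f t (f t)"
  proof (rule dependent_wf_choice[of "Wellfounded.measure list_code"])
    fix f g :: "nat list \<Rightarrow> nat list" and t r
    assume eq: "\<And>z. (z, t) \<in> Wellfounded.measure list_code \<Longrightarrow> f z = g z"
    then have "f q = g q" if "list_code q < list_code t" for q using that by simp
    then show "P f t r = P g t r"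
      unfolding P_def using list_code_snoc by metis
  next
    fix t and f :: "nat list \<Rightarrow> nat list"
    assume "\<And>y. (y, t) \<in> Wellfounded.measure list_code \<Longrightarrow> P f y (f y)"
    then have IH: "P f y (f y)" if "list_code y < list_code t" for y using that by simp
    show "\<exists>r. P f t r"
    proof (cases t rule: rev_cases)
      case Nil
      then show ?thesis by (simp add: P_def)
    next
      case (snoc s n)
      have s_less: "list_code s < list_code t" using snoc list_code_snoc by simp
      have ext: "strict_prefix (f q) (f q')"
        if "strict_prefix q q'" "list_code q' < list_code t" for q q'
        using that
      proof (induction q' rule: rev_induct)
        case (snoc m q')
        have less: "list_code q' < list_code t" using list_code_snoc[of q' m] snoc.prems(2) by simp
        obtain c u where "f (q' @ [m]) = f q' @ c # u"
          using IH[OF snoc.prems(2)] unfolding P_def by blast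
        then have "strict_prefix (f q') (f (q' @ [m]))" by (rule strict_prefixI')
        moreover have "q = q' \<or> strict_prefix q q'"
          using snoc.prems(1) by (auto simp: strict_prefix_def)
        ultimately show ?case using snoc.IH less prefix_order.less_trans by blast
      qed simp
      \<comment> \<open>The nodes already placed from which the new one must be kept
        incomparable.\<close>
      define E where "E = {q. list_code q < list_code t \<and> \<not> prefix q s}"
      have "finite E" unfolding E_def by (rule finite_subset[OF _ finite_list_code_less[of "list_code t"]]) auto
      have earlier: "\<not> x (f q) \<subseteq> x (f y) \<and> \<not> x (f y) \<subseteq> x (f q)"
        if "list_code q < list_code y" "list_code y < list_code t" "\<not> strict_prefix q y" for q y
      proof (cases y rule: rev_cases)
        case Nil
        then show ?thesis using that(1) by simp
      next
        case (snoc y' m)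
        then have "\<not> prefix q y'" using that(3) by (auto simp: strict_prefix_def)
        then show ?thesis using IH[OF that(2)] that(1) snoc unfolding P_def by blast
      qed
      have s_not: "\<not> x (f s) \<subseteq> x (f q)" and not_s: "\<not> strict_prefix s q \<longrightarrow> \<not> x (f q) \<subseteq> x (f s)"
        if q: "q \<in> E" for q
      proof -
        have q': "list_code q < list_code t" "\<not> prefix q s" "\<not> strict_prefix q s"
          using q unfolding E_def by auto
        then have "list_code q \<noteq> list_code s" by (auto simp: list_code_eq_iff)
        then consider "list_code q < list_code s" | "list_code s < list_code q" by linarith
        then have "\<not> x (f s) \<subseteq> x (f q) \<and> (\<not> strict_prefix s q \<longrightarrow> \<not> x (f q) \<subseteq> x (f s))"
        proof cases
          case 1
          then show ?thesis using earlier[OF 1 s_less q'(3)] by blast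
        next
          case 2
          show ?thesis
          proof (cases "strict_prefix s q")
            case True
            then show ?thesis using ext[OF True q'(1)] strict by blast
          next
            case False
            then show ?thesis using earlier[OF 2 q'(1)] by blast
          qed
        qed
        then show "\<not> x (f s) \<subseteq> x (f q)" "\<not> strict_prefix s q \<longrightarrow> \<not> x (f q) \<subseteq> x (f s)" by auto
      qed
      \<comment> \<open>No \<open>x (f q)\<close> with \<open>q \<in> E\<close> contains
        \<open>x (f s)\<close>; by convergence it then contains no far descendant of
        \<open>f s\<close> either.\<close>
      have "\<forall>q\<in>E. \<forall>\<^sub>F c in sequentially. \<forall>u. \<not> x (f s @ c # u) \<subseteq> x (f q)"
      proof
        fix q assume "q \<in> E"
        then obtain k where k: "k \<in> x (f s)" "k \<notin> x (f q)" using s_not by blast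
        obtain N where "\<forall>c\<ge>N. \<forall>u. k \<in> x (f s @ c # u)"
          using eventually_mem[of k "f s"] k(1) top by auto
        then show "\<forall>\<^sub>F c in sequentially. \<forall>u. \<not> x (f s @ c # u) \<subseteq> x (f q)"
          unfolding eventually_sequentially using k(2) by blast
      qed
      then have "\<forall>\<^sub>F c in sequentially. \<forall>q\<in>E. \<forall>u. \<not> x (f s @ c # u) \<subseteq> x (f q)"
        using \<open>finite E\<close> by (intro eventually_ball_finite) auto
      then obtain N where N: "\<And>c q u. N \<le> c \<Longrightarrow> q \<in> E \<Longrightarrow> \<not> x (f s @ c # u) \<subseteq> x (f q)"
        unfolding eventually_sequentially by blast
      \<comment> \<open>For the opposite inclusion only nodes above \<open>s\<close> matter: for the
        others \<open>x (f q)\<close> is not included even in \<open>x (f s)\<close>, which contains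
        all its descendants.\<close>
      define R where "R = f ` {q \<in> E. strict_prefix s q}"
      have "finite R" using \<open>finite E\<close> by (simp add: R_def)
      moreover have "strict_prefix (f s) r" if "r \<in> R" for r
        using that ext unfolding R_def E_def by blast
      ultimately obtain c u where cu: "max N n \<le> c" "\<forall>r\<in>R. \<not> x r \<subseteq> x (f s @ c # u)"
        using avoid[of R "f s" "max N n"] by blast
      have "\<not> x (f q) \<subseteq> x (f s @ c # u) \<and> \<not> x (f s @ c # u) \<subseteq> x (f q)" if q: "q \<in> E" for q
      proof (intro conjI)
        show "\<not> x (f s @ c # u) \<subseteq> x (f q)" using N cu(1) q by simp
        show "\<not> x (f q) \<subseteq> x (f s @ c # u)"
        proof (cases "strict_prefix s q")
          case True
          then show ?thesis using cu(2) q unfolding R_def by blast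
        next
          case False
          then show ?thesis using not_s[OF q] mono[of "f s" "f s @ c # u"] by auto
        qed
      qed
      moreover have "n \<le> c" using cu(1) by simp
      ultimately have "P f t (f s @ c # u)"
        unfolding P_def E_def using snoc by auto
      then show ?thesis ..
    qed
  qed simp
  then obtain \<phi> where \<phi>: "\<And>t. P \<phi> t (\<phi> t)" by blast
  have th: "thinning \<phi>" using \<phi> unfolding thinning_def P_def by blast
  interpret th: scheme X "\<lambda>s. x (\<phi> s)" "\<lambda>s. a (\<phi> s)" by (rule thin[OF th])
  have later: "\<not> x (\<phi> q) \<subseteq> x (\<phi> y) \<and> \<not> x (\<phi> y) \<subseteq> x (\<phi> q)"
    if "list_code q < list_code y" "\<not> strict_prefix q y" for q y
  proof (cases y rule: rev_cases)
    case Nil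
    then show ?thesis using that(1) by simp
  next
    case (snoc y' m)
    then have "\<not> prefix q y'" using that(2) by (auto simp: strict_prefix_def)
    then show ?thesis using \<phi>[of y] that(1) snoc unfolding P_def by blast
  qed
  show ?thesis
  proof (rule th.canonical_S_0_embedding)
    show "a (\<phi> s) = x (\<phi> s)" for s by (rule top)
    show "x (\<phi> t) \<subseteq> x (\<phi> s)" if "prefix s t" for s t
      using that thinning_prefix[OF th] by (force simp: prefix_def intro!: mono)
    show "prefix t s" if le: "x (\<phi> s) \<subseteq> x (\<phi> t)" for s t
    proof (rule ccontr)
      assume neg: "\<not> prefix t s"
      then have "list_code s \<noteq> list_code t" by (auto simp: list_code_eq_iff)
      then consider "list_code s < list_code t" | "list_code t < list_code s" by linarith
      then show False
      proof cases
        case 1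
        have "strict_prefix s t" using later[OF 1] le by blast
        then show False using strict[OF thinning_strict_prefix[OF th]] le by blast
      next
        case 2
        have "strict_prefix t s" using later[OF 2] le by blast
        then show False using neg by (simp add: strict_prefix_def)
      qed
    qed
  qed
qed

text \<open>Where \<open>avoid\<close> fails, there are finitely many points such that every point
  of the far subtrees contains one of them. Antitonicity then yields a single one that is contained
  in all points of some cone. If this happens densely, iteration gives an increasing sequence along
  a branch, hence a limit from below outside \<open>X\<close>.\<close>

lemma (in scheme) canonical_S_0_antimono:
  assumes top: "\<And>s. a s = x s"
    and sep: "\<And>s n. \<exists>k\<in>x s. \<forall>t. k \<notin> x (s @ n # t)"
    and mono: "\<And>s t. prefix s t \<Longrightarrow> x t \<subseteq> x s"
  shows "has_canonical X"
proof -
  define avoid where "avoid s \<longleftrightarrow> (\<forall>R N. finite R \<longrightarrow> (\<forall>r\<in>R. strict_prefix s r) \<longrightarrow>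
      (\<exists>n\<ge>N. \<exists>t. \<forall>r\<in>R. \<not> x r \<subseteq> x (s @ n # t)))" for s
  show ?thesis
  proof (cases "\<exists>r. \<forall>s. prefix r s \<longrightarrow> avoid s")
    case True
    then obtain r where r: "\<And>s. avoid (r @ s)" by (auto simp: prefix_def)
    interpret sh: scheme X "\<lambda>s. x (r @ s)" "\<lambda>s. a (r @ s)" by (rule thin[OF thinning_shift])
    show ?thesis
    proof (rule sh.canonical_S_0_avoiding)
      show "a (r @ s) = x (r @ s)" for s by (rule top)
      show "\<exists>k\<in>x (r @ s). \<forall>t. k \<notin> x (r @ s @ n # t)" for s n using sep[of "r @ s" n] by simp
      show "x (r @ t) \<subseteq> x (r @ s)" if "prefix s t" for s t using mono that by simp
      fix s :: "nat list" and R and N :: nat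
      assume R: "finite R" "\<And>q. q \<in> R \<Longrightarrow> strict_prefix s q"
      have "finite ((@) r ` R)" "\<forall>q\<in>(@) r ` R. strict_prefix (r @ s) q"
        using R by (auto simp: strict_prefix_def)
      then have "\<exists>n\<ge>N. \<exists>t. \<forall>q\<in>(@) r ` R. \<not> x q \<subseteq> x ((r @ s) @ n # t)"
        using r[of s] unfolding avoid_def by blast
      then show "\<exists>n\<ge>N. \<exists>t. \<forall>q\<in>R. \<not> x (r @ q) \<subseteq> x (r @ s @ n # t)" by simp
    qed
  next
    case False
    \<comment> \<open>If \<open>x r\<close> is not included in \<open>x (p @ u)\<close>, it is not
      included in any later point, so passing to \<open>p @ u\<close> discards \<open>r\<close> from
      the finite set.\<close>
    have fin: "\<exists>r\<in>R. \<exists>q. prefix p q \<and> (\<forall>t. x r \<subseteq> x (q @ t))"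
      if "finite R" "\<forall>t. \<exists>r\<in>R. x r \<subseteq> x (p @ t)" for R p
      using that
    proof (induction R arbitrary: p)
      case (insert r R)
      show ?case
      proof (cases "\<forall>t. x r \<subseteq> x (p @ t)")
        case True
        then show ?thesis by blast
      next
        case False
        then obtain u where u: "\<not> x r \<subseteq> x (p @ u)" by blast
        have "\<exists>r\<in>R. x r \<subseteq> x ((p @ u) @ t)" for t
        proof -
          have "\<not> x r \<subseteq> x (p @ u @ t)" using u mono[of "p @ u" "p @ u @ t"] by auto
          then show ?thesis using insert.prems[rule_format, of "u @ t"] by auto
        qed
        then obtain r' q where "r' \<in> R" "prefix (p @ u) q" "\<forall>t. x r' \<subseteq> x (q @ t)"
          using insert.IH[of "p @ u"] by blast
        moreover have "prefix p q" using \<open>prefix (p @ u) q\<close> append_prefixD by blast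
        ultimately show ?thesis by blast
      qed
    qed simp
    have step: "\<exists>q r. strict_prefix p q \<and> prefix p r \<and> (\<forall>t. x r \<subseteq> x (q @ t))" for p
    proof -
      obtain s where s: "prefix p s" "\<not> avoid s" using False by blast
      then have "\<exists>R N. finite R \<and> (\<forall>r\<in>R. strict_prefix s r) \<and> (\<forall>n\<ge>N. \<forall>t. \<exists>r\<in>R. x r \<subseteq> x (s @ n # t))"
        unfolding avoid_def by simp
      then obtain R N where R: "finite R" "\<forall>r\<in>R. strict_prefix s r"
        "\<forall>n\<ge>N. \<forall>t. \<exists>r\<in>R. x r \<subseteq> x (s @ n # t)"
        by (elim exE conjE)
      then have "\<forall>t. \<exists>r\<in>R. x r \<subseteq> x ((s @ [N]) @ t)" by simp
      then obtain r q where rq: "r \<in> R" "prefix (s @ [N]) q" "\<forall>t. x r \<subseteq> x (q @ t)"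
        using fin[OF R(1)] by blast
      have "strict_prefix s q" using rq(2) by (auto simp: prefix_def intro: strict_prefixI')
      then have "strict_prefix p q" using s(1) prefix_order.le_less_trans by blast
      moreover have "prefix p r"
        using s(1) R(2) rq(1) prefix_order.le_less_trans prefix_order.less_imp_le by blast
      ultimately show ?thesis using rq(3) by blast
    qed
    then obtain q r where qr: "\<And>p. strict_prefix p (q p)" "\<And>p. prefix p (r p)"
      "\<And>p t. x (r p) \<subseteq> x (q p @ t)" by metis
    define p where "p n = (q ^^ n) []" for n
    have p_Suc: "p (Suc n) = q (p n)" for n by (simp add: p_def)
    then have "strict_prefix (p n) (p (Suc n))" for n using qr(1) by simp
    then obtain b where b: "b \<notin> X" "\<And>q. (\<And>n. prefix (p n) (q n)) \<Longrightarrow> converges (\<lambda>n. x (q n)) b"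
      using branch_converges[of p] by blast
    have conv: "converges (\<lambda>n. x (r (p n))) b" by (rule b(2)) (rule qr(2))
    have "x (r (p n)) \<subseteq> x (r (p (Suc n)))" for n
    proof -
      \<comment> \<open>\<open>r (p (Suc n))\<close> lies in the cone of \<open>q (p n)\<close>, all
        of whose points contain \<open>x (r (p n))\<close>.\<close>
      obtain t where "r (p (Suc n)) = q (p n) @ t"
        using qr(2)[of "p (Suc n)"] by (auto simp: p_Suc prefix_def)
      then show ?thesis using qr(3)[of "p n" t] by simp
    qed
    then have "x (r (p n)) \<subseteq> b" for n by (rule increasing_converges_subset[OF conv])
    then show ?thesis by (rule converging_from_below[OF mem _ conv b(1)])
  qed
qed

lemma thinning_separated:
  assumes th: "thinning \<phi>" and sep: "\<forall>s n. \<exists>k\<in>x s. \<forall>t. k \<notin> x (s @ n # t)"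
  shows "\<exists>k\<in>x (\<phi> s). \<forall>t. k \<notin> x (\<phi> (s @ n # t))"
proof -
  obtain c u where cu: "\<phi> (s @ [n]) = \<phi> s @ c # u" using th unfolding thinning_def by blast
  obtain k where k: "k \<in> x (\<phi> s)" "\<And>t. k \<notin> x (\<phi> s @ c # t)" using sep by blast
  have "k \<notin> x (\<phi> (s @ n # t))" for t
  proof -
    obtain v where "\<phi> ((s @ [n]) @ t) = \<phi> (s @ [n]) @ v" using thinning_prefix[OF th] by blast
    then show ?thesis using cu k(2)[of "u @ v"] by simp
  qed
  with k(1) show ?thesis by blast
qed

text \<open>By \<open>low\<close> each child can be moved to a node whose point is included in that
  of its parent; composing along edges gives antitonicity.\<close>

lemma (in scheme) canonical_S_0:
  assumes top: "\<And>s. a s = x s"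
    and sep: "\<And>s n. \<exists>k\<in>x s. \<forall>t. k \<notin> x (s @ n # t)"
    and low: "\<And>s N. \<exists>n\<ge>N. \<exists>t. x (s @ n # t) \<subseteq> x s"
  shows "has_canonical X"
proof -
  define R where "R v n w \<longleftrightarrow> (\<exists>c\<ge>n. \<exists>t. w = v @ c # t) \<and> x w \<subseteq> x v" for v n w
  have step: "\<exists>w. True \<and> R v n w" for v n
  proof -
    obtain c t where "n \<le> c" "x (v @ c # t) \<subseteq> x v" using low[of n v] by blast
    then show ?thesis unfolding R_def by (intro exI[of _ "v @ c # t"]) auto
  qed
  have "\<exists>\<phi> :: nat list \<Rightarrow> nat list. \<phi> [] = [] \<and> (\<forall>s :: nat list. True) \<and> (\<forall>s n. R (\<phi> s) n (\<phi> (s @ [n])))"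
    by (rule tree_choice[of "\<lambda>_. True" "[]" R, OF TrueI step])
  then obtain \<phi> :: "nat list \<Rightarrow> nat list" where "\<forall>s n. R (\<phi> s) n (\<phi> (s @ [n]))"
    by (elim exE conjE)
  then have \<phi>: "\<forall>s n. (\<exists>c\<ge>n. \<exists>t. \<phi> (s @ [n]) = \<phi> s @ c # t) \<and> x (\<phi> (s @ [n])) \<subseteq> x (\<phi> s)"
    unfolding R_def .
  then have th: "thinning \<phi>" unfolding thinning_def by blast
  interpret th: scheme X "\<lambda>s. x (\<phi> s)" "\<lambda>s. a (\<phi> s)" by (rule thin[OF th])
  show ?thesis
  proof (rule th.canonical_S_0_antimono)
    show "a (\<phi> s) = x (\<phi> s)" for s by (rule top)
    show "\<exists>k\<in>x (\<phi> s). \<forall>t. k \<notin> x (\<phi> (s @ n # t))" for s n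
      by (rule thinning_separated[OF th]) (use sep in blast)
    show "x (\<phi> t) \<subseteq> x (\<phi> s)" if "prefix s t" for s t
    proof -
      have "x (\<phi> (s @ u)) \<subseteq> x (\<phi> s)" for u
      proof (induction u rule: rev_induct)
        case (snoc n u)
        have "x (\<phi> ((s @ u) @ [n])) \<subseteq> x (\<phi> (s @ u))" using \<phi> by blast
        with snoc show ?case by simp
      qed simp
      then show ?thesis using that by (auto simp: prefix_def)
    qed
  qed
qed

text \<open>If the nodes with eventually no point below \<open>a s\<close> are dense, thinning
  removes all inclusions. Otherwise, above some \<open>r\<close>, far subtrees keep offering points
  below \<open>a s\<close>: when \<open>a s = x s\<close>, these serve as the children in a copy of
  \<open>S_0\<close>, and when \<open>a r\<close> is outside \<open>X\<close>, they already form a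
  sequence converging to it from below.\<close>

lemma (in scheme) canonical_separated:
  assumes sep: "\<And>s n. \<exists>k\<in>x s. \<forall>t. k \<notin> x (s @ n # t)"
  shows "has_canonical X"
proof (cases "\<forall>r. \<exists>s. prefix r s \<and> (\<exists>N. \<forall>n\<ge>N. \<forall>t. \<not> x (s @ n # t) \<subseteq> a s)")
  case True
  then obtain \<phi> where th: "thinning \<phi>" and up: "\<forall>s n t. \<not> x (\<phi> (s @ n # t)) \<subseteq> a (\<phi> s)"
    using not_below_thinning by blast
  interpret th: scheme X "\<lambda>s. x (\<phi> s)" "\<lambda>s. a (\<phi> s)" by (rule thin[OF th])
  show ?thesis
  proof (rule th.canonical_S_2)
    show "\<not> x (\<phi> (s @ n # t)) \<subseteq> a (\<phi> s)" for s n t using up by blast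
    show "\<exists>k\<in>x (\<phi> s). \<forall>t. k \<notin> x (\<phi> (s @ n # t))" for s n
      by (rule thinning_separated[OF th]) (use sep in blast)
  qed
next
  case False
  then obtain r where r: "\<And>s N. prefix r s \<Longrightarrow> \<exists>n\<ge>N. \<exists>t. x (s @ n # t) \<subseteq> a s" by blast
  show ?thesis
  proof (cases "\<forall>s. a s = x s")
    case True
    interpret sh: scheme X "\<lambda>s. x (r @ s)" "\<lambda>s. a (r @ s)" by (rule thin[OF thinning_shift])
    show ?thesis
    proof (rule sh.canonical_S_0)
      show "a (r @ s) = x (r @ s)" for s using True by simp
      show "\<exists>k\<in>x (r @ s). \<forall>t. k \<notin> x (r @ s @ n # t)" for s n using sep[of "r @ s" n] by simp
      show "\<exists>n\<ge>N. \<exists>t. x (r @ s @ n # t) \<subseteq> x (r @ s)" for s N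
        using r[of "r @ s" N] True by simp
    qed
  next
    case False
    then have "a r \<notin> X" using node by blast
    obtain n t where nt: "\<And>N. N \<le> n N" "\<And>N. x (r @ n N # t N) \<subseteq> a r"
      using r[of r] by (metis prefix_order.refl)
    have "converges (\<lambda>N. x (r @ n N # t N)) (a r)"
      unfolding converges_def
    proof
      fix m
      obtain K where "\<forall>c\<ge>K. \<forall>u. agree m (x (r @ c # u)) (a r)" using lim by blast
      then show "\<exists>K. \<forall>i\<ge>K. agree m (x (r @ n i # t i)) (a r)" using nt(1) order_trans by blast
    qed
    then show ?thesis
      using nt(2) \<open>a r \<notin> X\<close> mem by (intro converging_from_below[of "\<lambda>N. x (r @ n N # t N)"]) auto
  qed
qed

section \<open>Construction of schemes\<close>

text \<open>Being covered, instead of being equal to a union, makes the notion hereditary for an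
  arbitrary \<open>small\<close>.\<close>

definition sigma_small :: "('b set \<Rightarrow> bool) \<Rightarrow> 'b set \<Rightarrow> bool" where
  "sigma_small small Z \<longleftrightarrow> (\<exists>W :: nat \<Rightarrow> 'b set. Z \<subseteq> (\<Union>n. W n) \<and> (\<forall>n. small (W n)))"

lemma sigma_small_subset: "sigma_small small Z \<Longrightarrow> Y \<subseteq> Z \<Longrightarrow> sigma_small small Y"
  unfolding sigma_small_def by (meson order_trans)

lemma small_imp_sigma_small: "small Z \<Longrightarrow> sigma_small small Z"
  unfolding sigma_small_def by (intro exI[of _ "\<lambda>_. Z"]) auto

lemma sigma_small_UN:
  fixes Z :: "'i :: countable \<Rightarrow> 'b set"
  assumes "\<And>i. sigma_small small (Z i)"
  shows "sigma_small small (\<Union>i. Z i)"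
proof -
  have "\<forall>i. \<exists>W :: nat \<Rightarrow> 'b set. Z i \<subseteq> (\<Union>n. W n) \<and> (\<forall>n. small (W n))"
    using assms unfolding sigma_small_def by simp
  from choice[OF this] obtain W :: "'i \<Rightarrow> nat \<Rightarrow> 'b set"
    where W: "\<forall>i. Z i \<subseteq> (\<Union>n. W i n) \<and> (\<forall>n. small (W i n))" ..
  define V where "V k = W (from_nat (fst (prod_decode k))) (snd (prod_decode k))" for k
  have "W i n \<subseteq> (\<Union>k. V k)" for i n
  proof -
    have "W i n = V (prod_encode (to_nat i, n))" by (simp add: V_def)
    then show ?thesis by blast
  qed
  then have "(\<Union>n. W i n) \<subseteq> (\<Union>k. V k)" for i by (rule UN_least)
  then have "Z i \<subseteq> (\<Union>k. V k)" for i
    by (rule order_trans[OF W[rule_format, THEN conjunct1]])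
  then have "(\<Union>i. Z i) \<subseteq> (\<Union>k. V k)" by (rule UN_least)
  moreover have "small (V k)" for k using W by (simp add: V_def)
  ultimately show ?thesis unfolding sigma_small_def by (intro exI[of _ V]) simp
qed

lemma not_sigma_small_UN:
  fixes W :: "'i :: countable \<Rightarrow> 'b set"
  assumes "\<not> sigma_small small Z" "Z \<subseteq> (\<Union>i. W i)"
  shows "\<exists>i. \<not> sigma_small small (W i)"
proof (rule ccontr)
  assume "\<nexists>i. \<not> sigma_small small (W i)"
  then have "sigma_small small (\<Union>i. W i)" by (intro sigma_small_UN) simp
  then show False using assms sigma_small_subset by metis
qed

lemma sigma_small_Un:
  assumes "sigma_small small Y" "sigma_small small Z"
  shows "sigma_small small (Y \<union> Z)"
proof -
  have "sigma_small small (\<Union>b. if b then Y else Z)"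
    by (rule sigma_small_UN) (use assms in auto)
  then show ?thesis by (rule sigma_small_subset) (auto split: if_splits)
qed

lemma sigma_small_UN_small:
  fixes Z :: "'i :: countable \<Rightarrow> 'b set"
  assumes "small {}"
  shows "sigma_small small (\<Union>i\<in>{i. sigma_small small (Z i)}. Z i)"
proof -
  have "sigma_small small (\<Union>i. if sigma_small small (Z i) then Z i else {})"
    by (rule sigma_small_UN) (use small_imp_sigma_small[of small, OF assms] in auto)
  then show ?thesis by (rule sigma_small_subset) auto
qed

lemma not_sigma_small_Diff:
  assumes "\<not> sigma_small small Y" "sigma_small small Z"
  shows "\<not> sigma_small small (Y - Z)"
proof
  assume "sigma_small small (Y - Z)"
  then have "sigma_small small (Y - Z \<union> Z)" using assms(2) by (rule sigma_small_Un)
  then show False using assms(1) sigma_small_subset[of small "Y - Z \<union> Z" Y] by blast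
qed

section \<open>Separation in both topologies and derivation of Souslin schemes\<close>

definition cantor_small :: "nat set set \<Rightarrow> nat set set \<Rightarrow> bool" where
  "cantor_small X Z \<longleftrightarrow> cantor_cl Z \<inter> X = {}"

text \<open>\<open>sigma_small (scott_small X) Z\<close> says that a Scott-\<open>\<Sigma>\<^sup>0\<^sub>2\<close> set separates \<open>Z\<close> from \<open>X\<close>, and
  \<open>sigma_small (cantor_small X) Z\<close> the same for Cantor-\<open>F\<^sub>\<sigma>\<close> sets.\<close>

definition scott_small :: "nat set set \<Rightarrow> nat set set \<Rightarrow> bool" where
  "scott_small X Z \<longleftrightarrow>
    (\<exists>F. finite F \<and> (\<forall>z\<in>Z. F \<subseteq> z) \<and> (\<forall>x\<in>X. F \<subseteq> x \<longrightarrow> x \<notin> scott_cl Z))"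

lemma cantor_small_empty: "cantor_small X {}"
  by (simp add: cantor_small_def cantor_cl_def)

lemma scott_small_empty: "scott_small X {}"
  unfolding scott_small_def by (intro exI[of _ "{}"]) (auto simp: scott_cl_def)

text \<open>A Souslin scheme whose pieces shrink in the Cantor sense along branches, to points
  outside \<open>X\<close>; a branch may skip levels. Countability of the index type makes the
  family of pieces countable, as pruning requires.\<close>

locale souslin =
  fixes X :: "nat set set" and A :: "'i :: countable list \<Rightarrow> nat set set"
  assumes split: "A s = (\<Union>i. A (s @ [i]))"
    and shrink: "(\<And>n. strict_prefix (p n) (p (Suc n))) \<Longrightarrow> (\<And>n. A (p n) \<noteq> {}) \<Longrightarrow>
      \<exists>b. b \<notin> X \<and> (\<forall>m. \<exists>n. \<forall>y\<in>A (p n). agree m y b)"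
begin

lemma antimono: "A (s @ t) \<subseteq> A s"
proof (induction t rule: rev_induct)
  case (snoc i t)
  have "A ((s @ t) @ [i]) \<subseteq> A (s @ t)" using split[of "s @ t"] by blast
  with snoc show ?case by simp
qed simp

text \<open>The pieces along a branch through \<open>y\<close> shrink to some \<open>b\<close>;
  since \<open>y\<close> lies in all of them, late pieces are close to \<open>y\<close>.\<close>

lemma small_neighbourhood:
  assumes y: "y \<in> A s"
  shows "\<exists>t. strict_prefix s t \<and> y \<in> A t \<and> (\<forall>z\<in>A t. agree n z y)"
proof -
  have step: "\<exists>q. y \<in> A q \<and> (\<exists>i. q = p @ [i])" if "y \<in> A p" for p
    using that split[of p] by blast
  have "\<exists>p. \<forall>k. (y \<in> A (p k) \<and> (k = 0 \<longrightarrow> p k = s)) \<and> (\<exists>i. p (Suc k) = p k @ [i])"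
    by (rule dependent_nat_choice) (use y step in auto)
  then obtain p where p: "\<And>k. y \<in> A (p k)" "p 0 = s" "\<And>k. \<exists>i. p (Suc k) = p k @ [i]"
    by blast
  have inc: "strict_prefix (p k) (p (Suc k))" for k
  proof -
    obtain i where "p (Suc k) = p k @ [i]" using p(3) by blast
    then show ?thesis by (rule strict_prefixI')
  qed
  have "A (p k) \<noteq> {}" for k using p(1) by blast
  then obtain b where b: "\<forall>m. \<exists>k. \<forall>z\<in>A (p k). agree m z b"
    using shrink[of p] inc by blast
  then obtain k where k: "\<forall>z\<in>A (p k). agree n z b" by blast
  \<comment> \<open>\<open>Suc k\<close> makes the extension strict also for
    \<open>k = 0\<close>.\<close>
  have "strict_prefix s (p (Suc k))"
  proof (induction k)
    case 0
    then show ?case using inc[of 0] p(2) by simp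
  next
    case (Suc k)
    then show ?case using inc[of "Suc k"] prefix_order.less_trans by blast
  qed
  moreover have "agree n z y" if "z \<in> A (p (Suc k))" for z
  proof -
    obtain i where "p (Suc k) = p k @ [i]" using p(3) by blast
    then have "z \<in> A (p k)" using that antimono[of "p k" "[i]"] by auto
    then show ?thesis using k p(1) agree_trans agree_sym by blast
  qed
  ultimately show ?thesis using p(1) by blast
qed

text \<open>The sigma-small pieces are countably many, so their union \<open>N\<close> is
  sigma-small. A piece not contained in \<open>N\<close> is not sigma-small, and it stays so when
  \<open>N\<close> is removed.\<close>

lemma prune:
  assumes "small {}"
  shows "\<exists>B :: 'i list \<Rightarrow> nat set set. souslin X B \<and> (\<forall>s. B s \<noteq> {} \<longrightarrow> \<not> sigma_small small (B s)) \<and>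
    (\<not> sigma_small small (A []) \<longrightarrow> B [] \<noteq> {})"
proof -
  define N where "N = (\<Union>s\<in>{s. sigma_small small (A s)}. A s)"
  define B where "B s = A s - N" for s
  have N: "sigma_small small N" unfolding N_def by (rule sigma_small_UN_small[of small, OF assms])
  have B: "B s \<noteq> {} \<longleftrightarrow> \<not> sigma_small small (A s)" for s
  proof
    assume "B s \<noteq> {}"
    then show "\<not> sigma_small small (A s)" unfolding B_def N_def by blast
  next
    assume "\<not> sigma_small small (A s)"
    then have "\<not> A s \<subseteq> N" using sigma_small_subset[OF N] by blast
    then show "B s \<noteq> {}" unfolding B_def by blast
  qed
  have "souslin X B"
  proof
    show "B s = (\<Union>i. B (s @ [i]))" for s unfolding B_def using split[of s] by blast
    fix p :: "nat \<Rightarrow> 'i list"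
    assume inc: "\<And>n. strict_prefix (p n) (p (Suc n))" and "\<And>n. B (p n) \<noteq> {}"
    then have "A (p n) \<noteq> {}" for n unfolding B_def by blast
    then obtain b where b: "b \<notin> X" "\<forall>m. \<exists>n. \<forall>y\<in>A (p n). agree m y b"
      using shrink[of p] inc by blast
    then show "\<exists>b. b \<notin> X \<and> (\<forall>m. \<exists>n. \<forall>y\<in>B (p n). agree m y b)"
      unfolding B_def by (metis DiffE)
  qed
  moreover have "\<not> sigma_small small (B s)" if "B s \<noteq> {}" for s
  proof -
    have "\<not> sigma_small small (A s)" using B[of s] that by simp
    then show ?thesis unfolding B_def by (rule not_sigma_small_Diff[OF _ N])
  qed
  ultimately show ?thesis using B[of "[]"] by (intro exI[of _ B]) simp
qed

text \<open>A node carries a piece and a point of \<open>X\<close> in its Cantor closure. For child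
  \<open>n\<close>, an element \<open>y\<close> of the piece approximates the point up to
  \<open>n\<close>, the piece is shrunk around \<open>y\<close>, and the closure of the smaller
  piece meets \<open>X\<close> because that piece is not small. The children thus converge to their
  parent, whence \<open>a = x\<close>.\<close>

lemma cantor_scheme:
  assumes "\<And>s. A s \<noteq> {} \<Longrightarrow> \<not> sigma_small (cantor_small X) (A s)" "A [] \<noteq> {}"
  shows "\<exists>x. scheme X x x"
proof -
  have point: "\<exists>x. x \<in> X \<and> x \<in> cantor_cl (A s)" if "A s \<noteq> {}" for s
  proof -
    have "\<not> cantor_small X (A s)"
      using assms(1)[OF that] small_imp_sigma_small[of "cantor_small X"] by blast
    then show ?thesis unfolding cantor_small_def by blast
  qed
  define I where "I v \<longleftrightarrow> snd v \<in> X \<and> snd v \<in> cantor_cl (A (fst v))" for v :: "'i list \<times> nat set"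
  define R where "R v n w \<longleftrightarrow> strict_prefix (fst v) (fst w) \<and> (\<forall>y\<in>A (fst w). agree n y (snd v))"
    for v w :: "'i list \<times> nat set" and n
  obtain x0 where "x0 \<in> X" "x0 \<in> cantor_cl (A [])" using point assms(2) by blast
  then have init: "I ([], x0)" by (simp add: I_def)
  have step: "\<exists>w. I w \<and> R v n w" if Iv: "I v" for v n
  proof -
    obtain y where y: "y \<in> A (fst v)" "agree n (snd v) y"
      using Iv unfolding I_def cantor_cl_def by blast
    obtain t where t: "strict_prefix (fst v) t" "y \<in> A t" "\<forall>z\<in>A t. agree n z y"
      using small_neighbourhood[OF y(1)] by blast
    obtain x where "x \<in> X" "x \<in> cantor_cl (A t)" using point[of t] t(2) by blast
    then have "I (t, x)" by (simp add: I_def)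
    moreover have "agree n z (snd v)" if "z \<in> A t" for z
      by (rule agree_trans[OF t(3)[rule_format, OF that] agree_sym[OF y(2)]])
    then have "R v n (t, x)" using t(1) by (simp add: R_def)
    ultimately show ?thesis by blast
  qed
  have "\<exists>\<phi> :: nat list \<Rightarrow> _. \<phi> [] = ([], x0) \<and> (\<forall>s. I (\<phi> s)) \<and> (\<forall>s n. R (\<phi> s) n (\<phi> (s @ [n])))"
    by (rule tree_choice[of I "([], x0)" R, OF init step])
  then obtain \<phi> :: "nat list \<Rightarrow> _" where \<phi>: "\<And>s. I (\<phi> s)" "\<And>s n. R (\<phi> s) n (\<phi> (s @ [n]))"
    by blast
  define x where "x s = snd (\<phi> s)" for s
  define \<sigma> where "\<sigma> s = fst (\<phi> s)" for s
  have x: "x s \<in> X" "x s \<in> cantor_cl (A (\<sigma> s))" for s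
    using \<phi>(1)[of s] by (auto simp: I_def x_def \<sigma>_def)
  have child: "strict_prefix (\<sigma> s) (\<sigma> (s @ [n]))" "\<And>y. y \<in> A (\<sigma> (s @ [n])) \<Longrightarrow> agree n y (x s)" for s n
    using \<phi>(2)[of s n] by (auto simp: R_def x_def \<sigma>_def)
  have pre: "prefix (\<sigma> s) (\<sigma> (s @ t))" for s t
  proof (induction t rule: rev_induct)
    case (snoc n t)
    then show ?case using child(1)[of "s @ t" n] by (auto simp: strict_prefix_def)
  qed simp
  have strict: "strict_prefix (\<sigma> s) (\<sigma> t)" if st: "strict_prefix s t" for s t
  proof -
    obtain n u where "t = s @ n # u" using st by (rule strict_prefixE')
    then show ?thesis using child(1)[of s n] pre[of "s @ [n]" u] prefix_order.less_le_trans by auto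
  qed
  have desc: "x (s @ t) \<in> cantor_cl (A (\<sigma> s))" for s t
  proof -
    obtain u where "\<sigma> (s @ t) = \<sigma> s @ u" using pre[of s t] by (auto simp: prefix_def)
    then have "A (\<sigma> (s @ t)) \<subseteq> A (\<sigma> s)" using antimono by simp
    then show ?thesis using x(2)[of "s @ t"] cantor_cl_mono by blast
  qed
  have "scheme X x x"
  proof
    show "\<exists>N. \<forall>n\<ge>N. \<forall>t. agree m (x (s @ n # t)) (x s)" for s m
    proof (intro exI[of _ m] allI impI)
      fix n t assume "m \<le> n"
      have "x (s @ n # t) \<in> cantor_cl (A (\<sigma> (s @ [n])))" using desc[of "s @ [n]" t] by simp
      then have "agree n (x (s @ n # t)) (x s)" using child(2) by (rule cantor_cl_agree)
      then show "agree m (x (s @ n # t)) (x s)" using \<open>m \<le> n\<close> by (rule agree_mono)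
    qed
    fix p :: "nat \<Rightarrow> nat list" assume inc: "\<And>n. strict_prefix (p n) (p (Suc n))"
    have ne: "A (\<sigma> (p n)) \<noteq> {}" for n using x(2)[of "p n"] by (auto simp: cantor_cl_def)
    have "strict_prefix (\<sigma> (p n)) (\<sigma> (p (Suc n)))" for n by (rule strict[OF inc])
    then obtain b where b: "b \<notin> X" "\<forall>m. \<exists>n. \<forall>y\<in>A (\<sigma> (p n)). agree m y b"
      using shrink[of "\<lambda>n. \<sigma> (p n)"] ne by blast
    have "\<exists>n. \<forall>t. agree m (x (p n @ t)) b" for m
    proof -
      obtain n where "\<forall>y\<in>A (\<sigma> (p n)). agree m y b" using b(2) by blast
      then have "agree m (x (p n @ t)) b" for t using cantor_cl_agree[OF desc] by blast
      then show ?thesis by blast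
    qed
    with b(1) show "\<exists>b. b \<notin> X \<and> (\<forall>m. \<exists>n. \<forall>t. agree m (x (p n @ t)) b)" by blast
  qed (use x in auto)
  then show ?thesis by blast
qed

end

text \<open>If no point of \<open>Z\<close> is approached from below by \<open>X\<close>, then
  \<open>Z\<close> is the union of the sets \<open>P m\<close>, and some \<open>P m\<close> is still
  Scott-inseparable. Removing its separable boxes leaves \<open>K\<close>. A point \<open>x\<close>
  of \<open>X\<close> obtained from \<open>K\<close> lies below a Cantor limit \<open>a\<close> of
  \<open>K\<close>, but not below the points of \<open>K\<close> near \<open>a\<close>; this gives
  the separating elements.\<close>

lemma canonical_of_cantor_separated:
  assumes big: "\<not> sigma_small (scott_small X) Z" and disj: "cantor_cl Z \<inter> X = {}"
  shows "has_canonical X"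
proof (cases "\<exists>a\<in>Z. \<forall>m. \<exists>x\<in>X. x \<subseteq> a \<and> agree m x a")
  case True
  then obtain a where a: "a \<in> Z" "\<forall>m. \<exists>x\<in>X. x \<subseteq> a \<and> agree m x a" by blast
  then obtain y where y: "\<And>m. y m \<in> X" "\<And>m. y m \<subseteq> a" "\<And>m. agree m (y m) a" by metis
  have "converges y a" unfolding converges_def using agree_mono[OF y(3)] by blast
  moreover have "a \<notin> X" using a(1) disj subset_cantor_cl[of Z] by auto
  ultimately show ?thesis by (intro converging_from_below[OF y(1,2)])
next
  case False
  define P where "P m = {a \<in> Z. \<forall>x\<in>X. x \<subseteq> a \<longrightarrow> \<not> agree m x a}" for m
  have "Z \<subseteq> (\<Union>m. P m)"
  proof
    fix a assume "a \<in> Z"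
    then obtain m where "\<forall>x\<in>X. x \<subseteq> a \<longrightarrow> \<not> agree m x a" using False by blast
    with \<open>a \<in> Z\<close> have "a \<in> P m" by (simp add: P_def)
    then show "a \<in> (\<Union>m. P m)" by blast
  qed
  from not_sigma_small_UN[OF big this]
  obtain m where m: "\<not> sigma_small (scott_small X) (P m)" ..
  \<comment> \<open>Traces of the countably many cylinders, each given by a length and the code of a
    finite set.\<close>
  define box where "box i = P m \<inter> {y. agree (fst i) y (set_decode (snd i))}" for i :: "nat \<times> nat"
  define N where "N = (\<Union>i\<in>{i. sigma_small (scott_small X) (box i)}. box i)"
  define K where "K = P m - N"
  have N: "sigma_small (scott_small X) N"
    unfolding N_def by (rule sigma_small_UN_small[of "scott_small X", OF scott_small_empty])
  have K_sub: "K \<subseteq> P m" "K \<subseteq> Z" unfolding K_def P_def by auto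
  have "\<not> P m \<subseteq> N" using m sigma_small_subset[OF N] by blast
  then have "K \<noteq> {}" unfolding K_def by blast
  have K_out: "a \<notin> X" if "a \<in> cantor_cl K" for a
    using cantor_cl_mono[OF K_sub(2)] disj that by auto
  have K_box: "\<not> scott_small X (K \<inter> {y. agree d y z})" if z: "z \<in> K" for z d
  proof
    assume small: "scott_small X (K \<inter> {y. agree d y z})"
    define i where "i = (d, set_encode (z \<inter> {..<d}))"
    have box: "box i = P m \<inter> {y. agree d y z}"
      by (auto simp: box_def i_def set_encode_inverse agree_def)
    have "sigma_small (scott_small X) (K \<inter> {y. agree d y z} \<union> N)"
      using small_imp_sigma_small[of "scott_small X", OF small] N by (rule sigma_small_Un)
    then have "sigma_small (scott_small X) (box i)"
      by (rule sigma_small_subset) (auto simp: box K_def)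
    then have "box i \<subseteq> N" unfolding N_def by blast
    moreover have "z \<in> box i" using z box K_sub by auto
    ultimately show False using z unfolding K_def by blast
  qed
  have point: "\<exists>x a. x \<in> X \<and> a \<in> cantor_cl K \<and> x \<subseteq> a \<and> agree d x z \<and> agree d a z"
    if z: "z \<in> K" for z d
  proof -
    define V where "V = K \<inter> {y. agree d y z}"
    \<comment> \<open>As the finite set in \<open>scott_small\<close>, it yields a point of
      \<open>X\<close> that contains it; being below \<open>a\<close>, that point then agrees with
      \<open>z\<close> below \<open>d\<close>.\<close>
    define F where "F = z \<inter> {..<d}"
    have "finite F" "\<forall>v\<in>V. F \<subseteq> v" by (auto simp: F_def V_def agree_def)
    then obtain x where x: "x \<in> X" "F \<subseteq> x" "x \<in> scott_cl V"
      using K_box[OF z, of d] unfolding V_def[symmetric] scott_small_def by blast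
    obtain a where a: "a \<in> cantor_cl V" "x \<subseteq> a" using scott_cl_subset_down[OF x(3)] by blast
    have az: "agree d a z" by (rule cantor_cl_agree[OF a(1)]) (simp add: V_def)
    have "V \<subseteq> K" by (simp add: V_def)
    then have "a \<in> cantor_cl K" using cantor_cl_mono a(1) by blast
    moreover have "agree d x z" using az a(2) x(2) by (auto simp: agree_def F_def)
    ultimately show ?thesis using x(1) a(2) az by blast
  qed
  \<comment> \<open>\<open>d\<close> is the precision up to which the subtree is frozen; it never
    falls below \<open>m\<close>, so the defining property of \<open>P m\<close> stays
    applicable.\<close>
  define I where "I v = (case v of (x, a, d) \<Rightarrow>
    x \<in> X \<and> a \<in> cantor_cl K \<and> x \<subseteq> a \<and> m \<le> d \<and> agree d x a)" for v :: "nat set \<times> nat set \<times> nat"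
  define R where "R v n w = (case v of (x, a, d) \<Rightarrow> case w of (x', a', d') \<Rightarrow>
    d < d' \<and> n \<le> d' \<and> agree (max d n) a' a \<and> (\<exists>k\<in>x. k < d' \<and> k \<notin> a'))"
    for v w :: "nat set \<times> nat set \<times> nat" and n
  obtain z0 where "z0 \<in> K" using \<open>K \<noteq> {}\<close> by blast
  obtain x0 a0 where "x0 \<in> X" "a0 \<in> cantor_cl K" "x0 \<subseteq> a0" "agree m x0 z0" "agree m a0 z0"
    using point[OF \<open>z0 \<in> K\<close>] by blast
  moreover from this have "agree m x0 a0" by (simp add: agree_def)
  ultimately have init: "I (x0, a0, m)" by (simp add: I_def)
  have step: "\<exists>w. I w \<and> R v n w" if Iv: "I v" for v n
  proof -
    obtain x a d where v: "v = (x, a, d)" by (cases v) auto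
    have xad: "x \<in> X" "a \<in> cantor_cl K" "x \<subseteq> a" "m \<le> d" "agree d x a"
      using Iv by (auto simp: I_def v)
    obtain z where z: "z \<in> K" "agree (max d n) a z" using xad(2) unfolding cantor_cl_def by blast
    have "agree m x z"
      using agree_mono[OF xad(5,4)] agree_mono[OF z(2), of m] xad(4) agree_trans by (simp add: le_max_iff_disj)
    then have "\<not> x \<subseteq> z" using z(1) K_sub(1) xad(1) unfolding P_def by blast
    then obtain k where k: "k \<in> x" "k \<notin> z" by blast
    \<comment> \<open>Freezing beyond \<open>k\<close> keeps \<open>k\<close> out of every point
      above this child.\<close>
    define d' where "d' = max (Suc d) (max n (Suc k))"
    obtain x' a' where x': "x' \<in> X" "a' \<in> cantor_cl K" "x' \<subseteq> a'" "agree d' x' z" "agree d' a' z"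
      using point[OF z(1)] by blast
    have "I (x', a', d')"
      using x' xad(4) agree_trans[OF x'(4) agree_sym[OF x'(5)]] by (auto simp: I_def d'_def)
    moreover have "agree (max d n) a' a"
      by (rule agree_trans[OF agree_mono[OF x'(5)] agree_sym[OF z(2)]]) (auto simp: d'_def)
    moreover have "k < d'" "k \<notin> a'" using x'(5) k(2) by (auto simp: agree_def d'_def)
    ultimately show ?thesis
      using k(1) by (intro exI[of _ "(x', a', d')"]) (auto simp: R_def v d'_def)
  qed
  have "\<exists>\<phi> :: nat list \<Rightarrow> _. \<phi> [] = (x0, a0, m) \<and> (\<forall>s. I (\<phi> s)) \<and> (\<forall>s n. R (\<phi> s) n (\<phi> (s @ [n])))"
    by (rule tree_choice[of I "(x0, a0, m)" R, OF init step])
  then obtain \<phi> :: "nat list \<Rightarrow> _" where \<phi>: "\<And>s. I (\<phi> s)" "\<And>s n. R (\<phi> s) n (\<phi> (s @ [n]))"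
    by blast
  define x where "x s = fst (\<phi> s)" for s
  define a where "a s = fst (snd (\<phi> s))" for s
  define d where "d s = snd (snd (\<phi> s))" for s
  have inv: "x s \<in> X" "a s \<in> cantor_cl K" "x s \<subseteq> a s" "agree (d s) (x s) (a s)" for s
    using \<phi>(1)[of s] by (auto simp: I_def x_def a_def d_def split: prod.splits)
  have child: "d s < d (s @ [n])" "n \<le> d (s @ [n])" "agree (max (d s) n) (a (s @ [n])) (a s)"
    "\<exists>k\<in>x s. k < d (s @ [n]) \<and> k \<notin> a (s @ [n])" for s n
    using \<phi>(2)[of s n] by (auto simp: R_def x_def a_def d_def split: prod.splits)
  have desc: "d s \<le> d (s @ t) \<and> agree (d s) (a (s @ t)) (a s)" for s t
  proof (induction t rule: rev_induct)
    case (snoc n t)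
    have "d s \<le> d (s @ t)" using snoc by blast
    then have "agree (d s) (a ((s @ t) @ [n])) (a (s @ t))"
      by (intro agree_mono[OF child(3)[where s = "s @ t" and n = n]]) simp
    then have "agree (d s) (a ((s @ t) @ [n])) (a s)" using snoc agree_trans by blast
    moreover have "d s \<le> d ((s @ t) @ [n])" using snoc child(1)[of "s @ t" n] by simp
    ultimately show ?case by simp
  qed simp
  have desc_x: "agree (d s) (x (s @ t)) (a s)" for s t
    using agree_mono[OF inv(4)[of "s @ t"]] desc[of s t] agree_trans by blast
  interpret scheme X x a
  proof
    show "x s \<in> X" "x s \<subseteq> a s" for s using inv by auto
    show "(\<forall>s. a s = x s) \<or> (\<forall>s. a s \<notin> X)" using K_out inv(2) by blast
    show "\<exists>N. \<forall>n\<ge>N. \<forall>t. agree l (x (s @ n # t)) (a s)" for s l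
    proof (intro exI[of _ l] allI impI)
      fix n t assume "l \<le> n"
      have "agree l (x ((s @ [n]) @ t)) (a (s @ [n]))"
        by (rule agree_mono[OF desc_x]) (use \<open>l \<le> n\<close> child(2)[of n s] in simp)
      moreover have "agree l (a (s @ [n])) (a s)"
        by (rule agree_mono[OF child(3)]) (use \<open>l \<le> n\<close> in simp)
      ultimately show "agree l (x (s @ n # t)) (a s)" using agree_trans by simp
    qed
    fix p :: "nat \<Rightarrow> nat list" assume inc: "\<And>n. strict_prefix (p n) (p (Suc n))"
    have d_inc: "n \<le> d (p n)" for n
    proof (induction n)
      case (Suc n)
      obtain c u where "p (Suc n) = p n @ c # u" using inc[of n] by (rule strict_prefixE')
      then have "d (p n) < d (p (Suc n))" using child(1)[of "p n" c] desc[of "p n @ [c]" u] by simp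
      with Suc show ?case by simp
    qed simp
    have pre: "prefix (p i) (p j)" if "i \<le> j" for i j
      using that
    proof (induction j rule: dec_induct)
      case (step n)
      then show ?case using inc[of n] prefix_order.trans strict_prefix_def by blast
    qed simp
    \<comment> \<open>The precision at \<open>p n\<close> is at least \<open>n\<close>, so bit
      \<open>k\<close> is frozen by stage \<open>Suc k\<close>.\<close>
    define b where "b = {k. k \<in> a (p (Suc k))}"
    have b: "agree n (a (p n)) b" for n
      unfolding agree_def
    proof (intro allI impI)
      fix k assume "k < n"
      then obtain t where t: "p n = p (Suc k) @ t" using pre[of "Suc k" n] by (auto simp: prefix_def)
      have "agree (Suc k) (a (p n)) (a (p (Suc k)))"
        unfolding t by (rule agree_mono[OF _ d_inc]) (use desc in blast)
      then show "k \<in> a (p n) \<longleftrightarrow> k \<in> b" by (simp add: agree_def b_def)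
    qed
    have "b \<in> cantor_cl (cantor_cl K)"
      unfolding cantor_cl_def[of "cantor_cl K"] using b inv(2) agree_sym by blast
    then have "b \<notin> X" using K_out by (simp add: cantor_cl_idem)
    moreover have "agree l (x (p l @ t)) b" for l t
      using agree_mono[OF desc_x d_inc] b agree_trans by blast
    ultimately show "\<exists>b. b \<notin> X \<and> (\<forall>m. \<exists>n. \<forall>t. agree m (x (p n @ t)) b)" by blast
  qed
  show ?thesis
  proof (rule canonical_separated)
    fix s n
    obtain k where k: "k \<in> x s" "k < d (s @ [n])" "k \<notin> a (s @ [n])" using child(4) by blast
    have "k \<notin> x (s @ n # t)" for t
      using desc_x[of "s @ [n]" t] k(2,3) by (simp add: agree_def)
    with k(1) show "\<exists>k\<in>x s. \<forall>t. k \<notin> x (s @ n # t)" by blast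
  qed
qed

lemma (in scheme) canonical:
  assumes "\<And>s. a s = x s"
  shows "has_canonical X"
proof -
  consider "has_canonical X"
    | \<phi> where "thinning \<phi>" "\<forall>s n. \<exists>k\<in>x (\<phi> s). \<forall>t. k \<notin> x (\<phi> (s @ n # t))"
    using separated_thinning[OF assms] by blast
  then show ?thesis
  proof cases
    case 2
    interpret th: scheme X "\<lambda>s. x (\<phi> s)" "\<lambda>s. a (\<phi> s)" by (rule thin[OF 2(1)])
    show ?thesis by (rule th.canonical_separated) (use 2(2) in blast)
  qed
qed

text \<open>If countably many sets whose Cantor closures miss \<open>X\<close> cover
  \<open>A []\<close>, one of them is still Scott-inseparable and feeds the second kind of scheme.
  Otherwise pruning leaves a nonempty kernel, from which the first kind is built.\<close>

lemma (in souslin) canonical: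
  assumes "\<not> sigma_small (scott_small X) (A [])"
  shows "has_canonical X"
proof (cases "sigma_small (cantor_small X) (A [])")
  case True
  then obtain W :: "nat \<Rightarrow> nat set set" where W: "A [] \<subseteq> (\<Union>n. W n)" "\<And>n. cantor_small X (W n)"
    unfolding sigma_small_def by blast
  from not_sigma_small_UN[OF assms W(1)]
  obtain n where "\<not> sigma_small (scott_small X) (W n)" ..
  then show ?thesis
    using W(2)[of n] unfolding cantor_small_def by (rule canonical_of_cantor_separated)
next
  case False
  obtain B :: "'i list \<Rightarrow> nat set set" where B: "souslin X B" "\<forall>s. B s \<noteq> {} \<longrightarrow> \<not> sigma_small (cantor_small X) (B s)"
    "\<not> sigma_small (cantor_small X) (A []) \<longrightarrow> B [] \<noteq> {}"
    using prune[of "cantor_small X", OF cantor_small_empty] by (elim exE conjE)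
  then obtain x where "scheme X x x" using souslin.cantor_scheme[OF B(1) B(2)[rule_format] B(3)[rule_format, OF False]] by blast
  then show ?thesis by (rule scheme.canonical) simp
qed

section \<open>Analytic sets and the dichotomy\<close>

text \<open>A Scott-continuous \<open>f\<close> becomes Cantor-continuous once its argument \<open>\<alpha>\<close> is paired with a code
  \<open>g\<close> that states for each \<open>i\<close> whether \<open>i \<in> f \<alpha>\<close> and, if so, which initial segment of \<open>\<alpha>\<close> forces
  this.\<close>

lemma continuous_image_souslin:
  assumes cont: "continuous_map baire_space scott_powerset f" and disj: "range f \<inter> X = {}"
  shows "\<exists>A :: (nat \<times> nat) list \<Rightarrow> nat set set. souslin X A \<and> A [] = range f"
proof -
  define forced where "forced \<alpha> k i \<longleftrightarrow> (\<forall>\<beta>. (\<forall>j<k. \<beta> j = \<alpha> j) \<longrightarrow> i \<in> f \<beta>)" for \<alpha> k i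
  have ex_forced: "\<exists>k. forced \<alpha> k i" if i: "i \<in> f \<alpha>" for \<alpha> i
  proof -
    have "openin scott_powerset {y. {i} \<subseteq> y}" by (rule openin_scott_supersets) simp
    then have "openin baire_space {\<alpha> \<in> topspace baire_space. f \<alpha> \<in> {y. {i} \<subseteq> y}}"
      by (rule openin_continuous_map_preimage[OF cont])
    then have "openin baire_space {\<alpha>. i \<in> f \<alpha>}" by simp
    then obtain U :: "nat \<Rightarrow> nat set" where U: "finite {i. U i \<noteq> UNIV}" "\<alpha> \<in> Pi\<^sub>E UNIV U"
      "Pi\<^sub>E UNIV U \<subseteq> {\<alpha>. i \<in> f \<alpha>}"
      using i unfolding baire_space_def openin_product_topology_alt by auto
    obtain k where k: "{i. U i \<noteq> UNIV} \<subseteq> {..<k}" using finite_nat_bounded[OF U(1)] by blast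
    have "i \<in> f \<beta>" if \<beta>: "\<forall>j<k. \<beta> j = \<alpha> j" for \<beta>
    proof -
      have "\<beta> j \<in> U j" for j
      proof (cases "U j = UNIV")
        case False
        then have "j < k" using k by blast
        then show ?thesis using \<beta> U(2) by (auto simp: PiE_iff)
      qed simp
      then have "\<beta> \<in> Pi\<^sub>E UNIV U" by (simp add: PiE_iff)
      then show ?thesis using U(3) by blast
    qed
    then show ?thesis unfolding forced_def by blast
  qed
  define codes where "codes \<alpha> g \<longleftrightarrow> (\<forall>i. (g i = 0 \<longrightarrow> i \<notin> f \<alpha>) \<and> (\<forall>k. g i = Suc k \<longrightarrow> forced \<alpha> k i))" for \<alpha> g
  have ex_codes: "\<exists>g. codes \<alpha> g" for \<alpha>
  proof -
    have "\<forall>i. \<exists>c. (c = 0 \<longrightarrow> i \<notin> f \<alpha>) \<and> (\<forall>k. c = Suc k \<longrightarrow> forced \<alpha> k i)"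
      using ex_forced by (metis nat.distinct(1) nat.inject)
    then show ?thesis unfolding codes_def by (rule choice)
  qed
  define A where "A s = {f \<alpha> | \<alpha>. \<exists>g. codes \<alpha> g \<and> (\<forall>i<length s. s ! i = (\<alpha> i, g i))}" for s
  have "souslin X A"
  proof
    show "A s = (\<Union>c. A (s @ [c]))" for s
    proof
      show "A s \<subseteq> (\<Union>c. A (s @ [c]))"
      proof
        fix y assume "y \<in> A s"
        then obtain \<alpha> g where *: "y = f \<alpha>" "codes \<alpha> g" "\<forall>i<length s. s ! i = (\<alpha> i, g i)"
          unfolding A_def by blast
        then have "\<forall>i<length (s @ [(\<alpha> (length s), g (length s))]).
            (s @ [(\<alpha> (length s), g (length s))]) ! i = (\<alpha> i, g i)"
          by (auto simp: nth_append less_Suc_eq)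
        then have "y \<in> A (s @ [(\<alpha> (length s), g (length s))])"
          using *(1,2) unfolding A_def by blast
        then show "y \<in> (\<Union>c. A (s @ [c]))" by blast
      qed
      have "A (s @ [c]) \<subseteq> A s" for c
      proof
        fix y assume "y \<in> A (s @ [c])"
        then obtain \<alpha> g where *: "y = f \<alpha>" "codes \<alpha> g"
          "\<forall>i<length (s @ [c]). (s @ [c]) ! i = (\<alpha> i, g i)"
          unfolding A_def by blast
        have "s ! i = (\<alpha> i, g i)" if "i < length s" for i
          using *(3)[rule_format, of i] that by (simp add: nth_append)
        then show "y \<in> A s" using *(1,2) unfolding A_def by blast
      qed
      then show "(\<Union>c. A (s @ [c])) \<subseteq> A s" by blast
    qed
    fix p :: "nat \<Rightarrow> (nat \<times> nat) list"
    assume inc: "\<And>n. strict_prefix (p n) (p (Suc n))"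
    have len: "n \<le> length (p n)" for n
    proof (induction n)
      case (Suc n)
      then show ?case using prefix_length_less[OF inc[of n]] by simp
    qed simp
    have pre: "prefix (p i) (p j)" if "i \<le> j" for i j
      using that
    proof (induction j rule: dec_induct)
      case (step n)
      then show ?case using inc[of n] prefix_order.trans strict_prefix_def by blast
    qed simp
    define \<alpha> where "\<alpha> i = fst (p (Suc i) ! i)" for i
    define g where "g i = snd (p (Suc i) ! i)" for i
    have p_nth: "p n ! i = (\<alpha> i, g i)" if "i < n" for i n
    proof -
      obtain u where "p n = p (Suc i) @ u" using pre[of "Suc i" n] \<open>i < n\<close> by (auto simp: prefix_def)
      moreover have "i < length (p (Suc i))" using len[of "Suc i"] by simp
      ultimately show ?thesis by (simp add: nth_append \<alpha>_def g_def)
    qed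
    have wit: "\<exists>\<beta> h. y = f \<beta> \<and> codes \<beta> h \<and> (\<forall>i<n. \<beta> i = \<alpha> i \<and> h i = g i)" if y: "y \<in> A (p n)" for y n
    proof -
      obtain \<beta> h where *: "y = f \<beta>" "codes \<beta> h" "\<forall>i<length (p n). p n ! i = (\<beta> i, h i)"
        using y unfolding A_def by blast
      have "\<beta> i = \<alpha> i \<and> h i = g i" if "i < n" for i
        using *(3) p_nth[OF that] len[of n] that by (metis less_le_trans prod.inject)
      then show ?thesis using * by blast
    qed
    \<comment> \<open>The limit \<open>g\<close> is not known to code the limit \<alpha>, so each
      entry is compared with the members \<open>y\<close> of a late piece, whose own codes
      \<open>h\<close> are correct. Entry 0 keeps \<open>i\<close> out of \<open>y\<close>, whereas
      \<open>i \<in> f \<alpha>\<close> would be forced early and put it in; entry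
      \<open>Suc k\<close> forces \<open>i\<close> into both \<open>y\<close> and
      \<open>f \<alpha>\<close>.\<close>
    have "\<exists>N. \<forall>n\<ge>N. \<forall>y\<in>A (p n). i \<in> y \<longleftrightarrow> i \<in> f \<alpha>" for i
    proof (cases "g i")
      case 0
      obtain k where k: "i \<in> f \<alpha> \<longrightarrow> forced \<alpha> k i" using ex_forced by blast
      have "i \<in> y \<longleftrightarrow> i \<in> f \<alpha>" if n: "max (Suc i) k \<le> n" and y: "y \<in> A (p n)" for n y
      proof -
        obtain \<beta> h where *: "y = f \<beta>" "codes \<beta> h" "\<forall>i<n. \<beta> i = \<alpha> i \<and> h i = g i"
          using wit[OF y] by blast
        have "h i = 0" using *(3) n 0 by simp
        then have "i \<notin> y" using *(1,2) unfolding codes_def by blast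
        moreover have "\<forall>j<k. \<beta> j = \<alpha> j" using *(3) n by simp
        ultimately show ?thesis using k *(1) unfolding forced_def by blast
      qed
      then show ?thesis by blast
    next
      case (Suc k)
      have "i \<in> y \<longleftrightarrow> i \<in> f \<alpha>" if n: "max (Suc i) k \<le> n" and y: "y \<in> A (p n)" for n y
      proof -
        obtain \<beta> h where *: "y = f \<beta>" "codes \<beta> h" "\<forall>i<n. \<beta> i = \<alpha> i \<and> h i = g i"
          using wit[OF y] by blast
        have "h i = Suc k" using *(3) n Suc by simp
        then have F: "forced \<beta> k i" using *(2) unfolding codes_def by blast
        moreover have "\<forall>j<k. \<alpha> j = \<beta> j" using *(3) n by simp
        ultimately show ?thesis using *(1) unfolding forced_def by blast
      qed
      then show ?thesis by blast
    qed
    then obtain N where N: "\<And>i n y. N i \<le> n \<Longrightarrow> y \<in> A (p n) \<Longrightarrow> i \<in> y \<longleftrightarrow> i \<in> f \<alpha>" by metis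
    have "\<forall>y\<in>A (p (\<Sum>i<m. N i)). agree m y (f \<alpha>)" for m
    proof (intro ballI)
      fix y assume y: "y \<in> A (p (\<Sum>i<m. N i))"
      have "N i \<le> (\<Sum>i<m. N i)" if "i < m" for i using that member_le_sum[of i "{..<m}" N] by simp
      then show "agree m y (f \<alpha>)" unfolding agree_def using N y by blast
    qed
    moreover have "f \<alpha> \<notin> X" using disj by blast
    ultimately show "\<exists>b. b \<notin> X \<and> (\<forall>m. \<exists>n. \<forall>y\<in>A (p n). agree m y b)" by blast
  qed
  moreover have "A [] = range f" unfolding A_def using ex_codes by auto
  ultimately show ?thesis by blast
qed

text \<open>A small piece \<open>W n\<close> lies in the part of its Scott closure that consists of
  supersets of \<open>F n\<close>. This part is a difference of two Scott-open sets and misses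
  \<open>X\<close>, so removing all such parts leaves a level-two set around
  \<open>X\<close>.\<close>

lemma sigma_scott_small_Pi0:
  assumes "sigma_small (scott_small X) Z"
  shows "\<exists>Q. Pi0 scott_powerset 2 Q \<and> X \<subseteq> Q \<and> Q \<inter> Z = {}"
proof -
  obtain W :: "nat \<Rightarrow> nat set set" where W: "Z \<subseteq> (\<Union>n. W n)" "\<forall>n. scott_small X (W n)"
    using assms unfolding sigma_small_def by blast
  have "\<forall>n. \<exists>F. finite F \<and> (\<forall>z\<in>W n. F \<subseteq> z) \<and> (\<forall>x\<in>X. F \<subseteq> x \<longrightarrow> x \<notin> scott_cl (W n))"
    using W(2) unfolding scott_small_def .
  from choice[OF this] obtain F where F: "\<forall>n. finite (F n) \<and> (\<forall>z\<in>W n. F n \<subseteq> z) \<and>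
      (\<forall>x\<in>X. F n \<subseteq> x \<longrightarrow> x \<notin> scott_cl (W n))" ..
  define Q where "Q = UNIV - (\<Union>n. {y. F n \<subseteq> y} - - scott_cl (W n))"
  have "openin scott_powerset (- scott_cl (W n))" for n
    unfolding openin_scott_iff
  proof
    fix y assume "y \<in> - scott_cl (W n)"
    then obtain G where "finite G" "G \<subseteq> y" "\<forall>z\<in>W n. \<not> G \<subseteq> z"
      unfolding scott_cl_def by blast
    then show "\<exists>G. finite G \<and> G \<subseteq> y \<and> {A. G \<subseteq> A} \<subseteq> - scott_cl (W n)"
      by (intro exI[of _ G]) (auto simp: scott_cl_def)
  qed
  moreover have "openin scott_powerset {y. F n \<subseteq> y}" for n
    using F by (simp add: openin_scott_supersets)
  ultimately have "Pi0 scott_powerset 2 Q"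
    unfolding Pi0_2_iff topspace_scott_powerset Q_def
    by (intro exI[of _ "\<lambda>n. {y. F n \<subseteq> y}"] exI[of _ "\<lambda>n. - scott_cl (W n)"]) simp
  moreover have "X \<subseteq> Q" unfolding Q_def using F by auto
  moreover have "Q \<inter> Z = {}"
  proof -
    have "z \<notin> Q" if z: "z \<in> W n" for z n
    proof -
      have "F n \<subseteq> z" using F z by blast
      moreover have "z \<in> scott_cl (W n)" unfolding scott_cl_def using z by blast
      ultimately have "z \<in> {y. F n \<subseteq> y} - - scott_cl (W n)" by simp
      then show ?thesis unfolding Q_def by blast
    qed
    then show ?thesis using W(1) by blast
  qed
  ultimately show ?thesis by blast
qed

text \<open>A homeomorphism \<open>h\<close> of \<open>Y\<close> onto a level-two set
  \<open>P\<close> moves the question into P(\<omega>): the image of \<open>X\<close> is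
  \<open>P\<close> minus a continuous image of the Baire space, if not all of \<open>P\<close>, and
  the outcome hinges on whether that continuous image is Scott-separable from it.\<close>

theorem theorem7p2:
  fixes Y :: "'a topology" and X :: "'a set"
  assumes "quasi_polish Y" and "coanalytic_in Y X"
  shows "quasi_polish (subtopology Y X) \<or>
    (\<exists>S. Pi0 (subtopology Y X) 2 S \<and>
      (subtopology (subtopology Y X) S homeomorphic_space S_0 \<or>
       subtopology (subtopology Y X) S homeomorphic_space S_D \<or>
       subtopology (subtopology Y X) S homeomorphic_space S_1 \<or>
       subtopology (subtopology Y X) S homeomorphic_space S_2))"
proof -
  obtain A where A: "analytic_in Y A" "X = topspace Y - A"
    using assms(2) unfolding coanalytic_in_def by blast
  show ?thesis
  proof (cases "A = {}")
    case True
    then show ?thesis using assms(1) A(2) by simp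
  next
    case False
    then obtain f where f: "continuous_map baire_space Y f" "A = range f"
      using A(1) unfolding analytic_in_def by blast
    obtain P h where P: "Pi0 scott_powerset 2 P"
      and h: "homeomorphic_map Y (subtopology scott_powerset P) h"
      using assms(1) unfolding quasi_polish_def homeomorphic_space by blast
    have h_cont: "continuous_map Y scott_powerset h"
      using homeomorphic_imp_continuous_map[OF h] continuous_map_in_subtopology by blast
    have h_surj: "h ` topspace Y = P" using homeomorphic_imp_surjective_map[OF h] by simp
    have h_inj: "inj_on h (topspace Y)" by (rule homeomorphic_imp_injective_map[OF h])
    have f_top: "range f \<subseteq> topspace Y" using continuous_map_image_subset_topspace[OF f(1)] by simp
    have X_top: "X \<subseteq> topspace Y" using A(2) by blast
    have sub: "subtopology Y S homeomorphic_space subtopology scott_powerset (h ` S)"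
      if S: "S \<subseteq> topspace Y" for S
    proof -
      have "h ` (topspace Y \<inter> S) = topspace (subtopology scott_powerset P) \<inter> h ` S"
        using S h_surj by auto
      then have "homeomorphic_map (subtopology Y S) (subtopology (subtopology scott_powerset P) (h ` S)) h"
        by (rule homeomorphic_map_subtopologies[OF h])
      moreover have "P \<inter> h ` S = h ` S" using S h_surj by blast
      ultimately show ?thesis
        using homeomorphic_map_imp_homeomorphic_space by (simp add: subtopology_subtopology)
    qed
    have disj: "range (h \<circ> f) \<inter> h ` X = {}"
      using inj_on_image_Int[OF h_inj f_top X_top] A(2) f(2) by (auto simp: image_comp[symmetric])
    obtain T :: "(nat \<times> nat) list \<Rightarrow> nat set set"
      where T: "souslin (h ` X) T" "T [] = range (h \<circ> f)"
      using continuous_image_souslin[OF continuous_map_compose[OF f(1) h_cont] disj] by blast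
    show ?thesis
    proof (cases "sigma_small (scott_small (h ` X)) (T [])")
      case True
      then obtain Q where Q: "Pi0 scott_powerset 2 Q" "h ` X \<subseteq> Q" "Q \<inter> range (h \<circ> f) = {}"
        using sigma_scott_small_Pi0 T(2) by metis
      \<comment> \<open>Inside \<open>P\<close>, the separating set \<open>Q\<close> can contain
        only points of the image of \<open>X\<close>.\<close>
      have "P - h ` X \<subseteq> range (h \<circ> f)" using h_surj A(2) f(2) by auto
      moreover have "h ` X \<subseteq> P" using X_top h_surj by blast
      ultimately have "h ` X = P \<inter> Q" using Q(2,3) by blast
      then have "Pi0 scott_powerset 2 (h ` X)" using Pi0_2_Int[OF P Q(1)] by simp
      then have "quasi_polish (subtopology Y X)"
        unfolding quasi_polish_def using sub[OF X_top] by blast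
      then show ?thesis ..
    next
      case False
      then have "has_canonical (h ` X)" by (rule souslin.canonical[OF T(1)])
      then obtain Q where Q: "Pi0 scott_powerset 2 Q"
        "subtopology scott_powerset (h ` X \<inter> Q) homeomorphic_space S_0 \<or>
         subtopology scott_powerset (h ` X \<inter> Q) homeomorphic_space S_D \<or>
         subtopology scott_powerset (h ` X \<inter> Q) homeomorphic_space S_1 \<or>
         subtopology scott_powerset (h ` X \<inter> Q) homeomorphic_space S_2"
        unfolding has_canonical_def by blast
      define S where "S = {x \<in> X. h x \<in> Q}"
      obtain U V where UV: "\<forall>i::nat. openin scott_powerset (U i) \<and> openin scott_powerset (V i)"
        "Q = UNIV - (\<Union>i. U i - V i)"
        using Q(1) unfolding Pi0_2_iff topspace_scott_powerset by blast
      define pre where "pre B = {x \<in> topspace (subtopology Y X). h x \<in> B}" for B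
      have "openin (subtopology Y X) (pre B)" if "openin scott_powerset B" for B
        unfolding pre_def
        by (rule openin_continuous_map_preimage[OF continuous_map_from_subtopology[OF h_cont] that])
      then have "\<forall>i. openin (subtopology Y X) (pre (U i)) \<and> openin (subtopology Y X) (pre (V i))"
        using UV(1) by simp
      moreover have "S = topspace (subtopology Y X) - (\<Union>i. pre (U i) - pre (V i))"
        using X_top by (auto simp: S_def pre_def UV(2))
      ultimately have "Pi0 (subtopology Y X) 2 S"
        unfolding Pi0_2_iff
        by (intro exI[of _ "\<lambda>i. pre (U i)"] exI[of _ "\<lambda>i. pre (V i)"] conjI)
      moreover have "subtopology (subtopology Y X) S homeomorphic_space
          subtopology scott_powerset (h ` X \<inter> Q)"
      proof -
        have "X \<inter> S = S" "h ` S = h ` X \<inter> Q" "S \<subseteq> topspace Y"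
          using X_top by (auto simp: S_def)
        then show ?thesis using sub[of S] by (simp add: subtopology_subtopology)
      qed
      ultimately show ?thesis using Q(2) by (meson homeomorphic_space_trans)
    qed
  qed
qed

end
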